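(* Let $m\ge 1$. For any $\delta>0$ there exists $\epsilon=\epsilon(\delta)>0$ (depending only on $\delta$ and $m$) such that the following holds. Let $V$ be a finite-dimensional vector space over a finite field $k$, let $H$ be an abelian group, let $X\subset V$ be an $(\epsilon,m)$-uniform subset of density $>\delta$, and let $f:X\to H$ be a function such that $f_m|_{C_m(X)}\equiv 0$. Then there exists a function $h:V\to H$ with $h_m\equiv 0$ on $C_m(V)$ such that $h|_X=f$. Moreover, one can take $\epsilon=\delta^{O_m(1)}$, i.e. $\epsilon$ can be taken to be $\delta$ raised to a power bounded in terms of $m$ only.
   Context: An $m$-cube in $V$ is $(u|\bar v)$ with $u\in V$, $\bar v=(v_1,\dots,v_m)\in V^m$; its vertices are the $2^m$ points $u+\omega\cdot\bar v$, where $\omega=(\omega_1,\dots,\omega_m)\in\{0,1\}^m$ and $\omega\cdot\bar v=\sum_i\omega_i v_i$. For $X\subset V$, $C_m(X)$ is the set of $m$-cubes all of whose vertices lie in $X$. With $|\omega|=\sum_i\omega_i$, for $f:X\to H$ define $f_m:C_m(X)\to H$ by $f_m(u|\bar v)=\sum_{\omega\in\{0,1\}^m}(-1)^{|\omega|}f(u+\omega\cdot\bar v)$ (and similarly $h_m$ on $C_m(V)$ for $h:V\to H$). For $g:V\to\mathbb C$ the Gowers norm is defined by $\|g\|_{U_m}^{2^m}=\mathbb E_{x,v_1,\dots,v_m\in V}\prod_{\omega\in\{0,1\}^m}g^{\omega}(x+\omega\cdot\bar v)$, where $g^\omega=g$ if $|\omega|$ is even and $g^\omega=\bar g$ otherwise,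 and $\mathbb E$ denotes the average. The density of $X\subset V$ is $\mathbb E 1_X=|X|/|V|$. $X\subset V$ is $(\epsilon,m)$-uniform if $\|1_X-\mathbb E 1_X\|_{U_m}<\epsilon$. *)

theory Defs
  imports Complex_Main "HOL-Library.FuncSet" "HOL-Library.Indicator_Function" "HOL-Algebra.Module"
begin

(* A vector omega in {0,1}^m is encoded by its support, a subset of {..<m}; thus |omega| is
   the cardinality, and the tuple (v_1,...,v_m) is an extensional function on {..<m}. *)

definition cube_vertex ::
    "('k, 'v) module \<Rightarrow> 'v \<Rightarrow> (nat \<Rightarrow> 'v) \<Rightarrow> nat set \<Rightarrow> 'v" where
  "cube_vertex V u v \<omega> = u \<oplus>\<^bsub>V\<^esub> (\<Oplus>\<^bsub>V\<^esub>i\<in>\<omega>. v i)"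

definition cubes ::
    "('k, 'v) module \<Rightarrow> nat \<Rightarrow> 'v set \<Rightarrow> ('v \<times> (nat \<Rightarrow> 'v)) set" where
  "cubes V m X =
     {(u, v). u \<in> carrier V \<and> v \<in> {..<m} \<rightarrow>\<^sub>E carrier V \<and>
              (\<forall>\<omega>\<in>Pow {..<m}. cube_vertex V u v \<omega> \<in> X)}"

(* f_m(u|v); only the additive group of the record H is used. *)
definition cube_sum ::
    "('k, 'v) module \<Rightarrow> 'h ring \<Rightarrow> nat \<Rightarrow> ('v \<Rightarrow> 'h) \<Rightarrow> 'v \<times> (nat \<Rightarrow> 'v) \<Rightarrow> 'h" where
  "cube_sum V H m f = (\<lambda>(u, v).
     \<Oplus>\<^bsub>H\<^esub>\<omega>\<in>Pow {..<m}.
       if even (card \<omega>) then f (cube_vertex V u v \<omega>)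
       else \<ominus>\<^bsub>H\<^esub> f (cube_vertex V u v \<omega>))"

definition average :: "'a set \<Rightarrow> ('a \<Rightarrow> complex) \<Rightarrow> complex" where
  "average A g = (\<Sum>a\<in>A. g a) / of_nat (card A)"

(* For m >= 1 the average below is a nonnegative real number (this fails for m = 0). *)
definition gowers_norm :: "('k, 'v) module \<Rightarrow> nat \<Rightarrow> ('v \<Rightarrow> complex) \<Rightarrow> real" where
  "gowers_norm V m g =
     root (2 ^ m) (Re (average (carrier V \<times> ({..<m} \<rightarrow>\<^sub>E carrier V)) (\<lambda>(x, v).
       \<Prod>\<omega>\<in>Pow {..<m}.
         if even (card \<omega>) then g (cube_vertex V x v \<omega>)
         else cnj (g (cube_vertex V x v \<omega>)))))"

definition density :: "('k, 'v) module \<Rightarrow> 'v set \<Rightarrow> real" where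
  "density V X = real (card X) / real (card (carrier V))"

definition uniform_subset :: "('k, 'v) module \<Rightarrow> real \<Rightarrow> nat \<Rightarrow> 'v set \<Rightarrow> bool" where
  "uniform_subset V \<epsilon> m X \<longleftrightarrow>
     X \<subseteq> carrier V \<and>
     gowers_norm V m (\<lambda>x. indicator X x - complex_of_real (density V X)) < \<epsilon>"

definition fin_dim_vector_space :: "'k ring \<Rightarrow> ('k, 'v) module \<Rightarrow> bool" where
  "fin_dim_vector_space K V \<longleftrightarrow>
     Ring.field K \<and> Module.module K V \<and>
     (\<exists>B. finite B \<and> B \<subseteq> carrier V \<and>
        (\<forall>x\<in>carrier V. \<exists>a\<in>B \<rightarrow> carrier K. x = (\<Oplus>\<^bsub>V\<^esub>b\<in>B. a b \<odot>\<^bsub>V\<^esub> b)))"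

(* The assertion that epsilon is good for delta (and m), for all finite fields, vector spaces
   and abelian groups whose elements are taken from the types 'k, 'v and 'h. *)
definition extension_property ::
    "'k itself \<Rightarrow> 'v itself \<Rightarrow> 'h itself \<Rightarrow> nat \<Rightarrow> real \<Rightarrow> real \<Rightarrow> bool" where
  "extension_property _ _ _ m \<delta> \<epsilon> \<longleftrightarrow>
     (\<forall>(K :: 'k ring) (V :: ('k, 'v) module) (H :: 'h ring) X f.
        finite (carrier K) \<longrightarrow> fin_dim_vector_space K V \<longrightarrow> abelian_group H \<longrightarrow>
        uniform_subset V \<epsilon> m X \<longrightarrow> density V X > \<delta> \<longrightarrow>
        f \<in> X \<rightarrow> carrier H \<longrightarrow> (\<forall>c\<in>cubes V m X. cube_sum V H m f c = \<zero>\<^bsub>H\<^esub>) \<longrightarrow>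
        (\<exists>h\<in>carrier V \<rightarrow> carrier H.
           (\<forall>c\<in>cubes V m (carrier V). cube_sum V H m h c = \<zero>\<^bsub>H\<^esub>) \<and>
           (\<forall>x\<in>X. h x = f x)))"

(* HOL has no quantifier over types, so "there is epsilon, depending only on m and delta, such
   that for all K, V, H ..." cannot be written with K, V, H ranging over arbitrary types inside
   the existential: the witness could then depend on the types.  The theorem about this property
   therefore has two parts: a closed one, which finds the exponent (hence epsilon) over the
   fixed type nat, and a second, polymorphic one, saying that any epsilon good over nat is good
   over all types.  Together they give an exponent depending on m alone. *)

end

theory Submission
  imports Defs "HOL-Algebra.Weak_Morphisms" "HOL-Algebra.Generated_Groups" "HOL-Library.Countable_Set"
begin

text \<open>
  Call \<open>p = (p\<^sub>1, \<dots>, p\<^sub>m)\<close> a corner at \<open>x\<close> if \<open>x + \<eta> \<cdot> p \<in> X\<close> for every nonempty \<open>\<eta>\<close>.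
  The vanishing of \<open>h\<^sub>m\<close> on the cube \<open>(x|p)\<close> forces \<open>h x\<close> to be the value of the corner, minus the
  alternating sum of \<open>f\<close> over the vertices other than \<open>x\<close>; so \<open>h x\<close> has to be defined as the value
  of any corner at \<open>x\<close>.  Then \<open>h = f\<close> on \<open>X\<close> by the hypothesis on \<open>f\<close>, and it remains to see that
  corners exist at every point, that all corners at \<open>x\<close> have the same value, and that \<open>h\<^sub>m = 0\<close>.

  All three follow from one counting result (\<open>configuration_exists\<close>).  Given a point \<open>y\<^sub>\<omega>\<close> for
  every \<open>\<omega> \<in> {0,1,2}\<^sup>m\<close>, there are vectors \<open>r(i,\<tau>,j)\<close> such that
  \<open>y\<^sub>\<omega> + (\<Sum>i<m. \<Sum>j\<in>\<eta>. r(i,\<omega>\<^sub>i,j)) \<in> X\<close> for all \<open>\<omega>\<close> and all nonempty \<open>\<eta>\<close>; in other words,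
  \<open>p\<^sub>j = (\<Sum>i<m. r(i,\<omega>\<^sub>i,j))\<close> is a corner at \<open>y\<^sub>\<omega>\<close>.  Let \<open>\<omega>\<close> run over \<open>{0,1}\<^sup>m\<close> and let \<open>y\<close> be an
  \<open>m\<close>-cube.  For fixed \<open>\<eta>\<close> the points above then form an \<open>m\<close>-cube in \<open>X\<close>, so the alternating sum of
  \<open>f\<close> over them is zero; interchanging the sums over \<open>\<omega>\<close> and \<open>\<eta>\<close> shows that the values of the
  corners have alternating sum zero along \<open>y\<close> (\<open>corner_values_alternating_sum\<close>).  If \<open>y\<close> is an
  arbitrary cube, this is \<open>h\<^sub>m = 0\<close>.  If \<open>y\<^sub>\<omega> = x + \<omega> \<cdot> v\<close> for a corner \<open>v\<close> at \<open>x\<close>, all vertices but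
  \<open>x\<close> lie in \<open>X\<close>, where values of corners are values of \<open>f\<close>, and the identity says that \<open>v\<close> and the
  corner found at \<open>y\<^sub>0 = x\<close> have the same value.  The letter \<open>2\<close> serves to compare a second corner
  \<open>v'\<close> with that same corner.

  The count rests on a generalized von Neumann inequality (\<open>generalized_von_neumann\<close>): in an average
  over all \<open>r\<close>, a factor \<open>1\<^sub>X - \<alpha>\<close> at a form costs at most the \<open>U\<^sub>m\<close> norm, provided that the form
  contains \<open>m\<close> variables such that every other factor is free of one of them.  If indicators are
  replaced by the density \<open>\<alpha>\<close> in decreasing order of the cardinality of \<open>\<eta>\<close>, such variables exist at
  every step: \<open>r(i,\<omega>\<^sub>i,j\<^sub>i)\<close> for \<open>i < m\<close>, with \<open>j\<^sub>i = i\<close> whenever \<open>i \<in> \<eta>\<close>.  Other values of \<open>\<omega>\<close> miss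
  one of them because they disagree with \<open>\<omega>\<close> somewhere, other sets \<open>\<eta>'\<close> because they omit an element
  of \<open>\<eta>\<close>.  With \<open>N\<close> forms the average is at least \<open>\<alpha>\<^sup>N - N \<epsilon>\<close>, positive for \<open>\<epsilon> = \<delta>\<^sup>C\<close> with \<open>C\<close> large
  unless \<open>\<delta>\<close> is close to 1; in that range the union bound \<open>1 - N (1 - \<alpha>)\<close> takes over.

  Finally, a property that holds for all structures on the natural numbers holds for all structures:
  \<open>V\<close> and \<open>k\<close> are finite, and \<open>H\<close> may be replaced by the countable subgroup that \<open>f(X)\<close> generates.
\<close>

section \<open>Averages over finite sets\<close>

definition mean :: "'a set \<Rightarrow> ('a \<Rightarrow> real) \<Rightarrow> real" where
  "mean A f = (\<Sum>a\<in>A. f a) / real (card A)"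

lemma mean_cong: "A = B \<Longrightarrow> (\<And>a. a \<in> B \<Longrightarrow> f a = g a) \<Longrightarrow> mean A f = mean B g"
  by (simp add: mean_def)

lemma mean_const: "finite A \<Longrightarrow> A \<noteq> {} \<Longrightarrow> mean A (\<lambda>_. c) = c"
  by (simp add: mean_def)

lemma mean_add: "mean A (\<lambda>a. f a + g a) = mean A f + mean A g"
  by (simp add: mean_def sum.distrib add_divide_distrib)

lemma mean_diff: "mean A (\<lambda>a. f a - g a) = mean A f - mean A g"
  by (simp add: mean_def sum_subtractf diff_divide_distrib)

lemma mean_cmult: "mean A (\<lambda>a. c * f a) = c * mean A f"
  by (simp add: mean_def sum_distrib_left)

lemma mean_multc: "mean A (\<lambda>a. f a * c) = mean A f * c"
  by (simp add: mean_def sum_distrib_right)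

lemma mean_mono: "(\<And>a. a \<in> A \<Longrightarrow> f a \<le> g a) \<Longrightarrow> mean A f \<le> mean A g"
  by (simp add: mean_def sum_mono divide_right_mono)

lemma mean_nonneg: "(\<And>a. a \<in> A \<Longrightarrow> 0 \<le> f a) \<Longrightarrow> 0 \<le> mean A f"
  by (simp add: mean_def sum_nonneg)

lemma mean_Times: "mean A (\<lambda>a. mean B (f a)) = mean (A \<times> B) (\<lambda>p. f (fst p) (snd p))"
proof -
  have "(\<Sum>a\<in>A. \<Sum>b\<in>B. f a b) = (\<Sum>p\<in>A \<times> B. f (fst p) (snd p))"
    by (simp add: sum.cartesian_product split_def)
  then show ?thesis
    by (simp add: mean_def card_cartesian_product sum_divide_distrib [symmetric] mult.commute)
qed

lemma mean_commute: "mean A (\<lambda>a. mean B (f a)) = mean B (\<lambda>b. mean A (\<lambda>a. f a b))"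
  by (simp add: mean_def sum_divide_distrib [symmetric] mult.commute sum.swap [of f B A])

lemma mean_reindex: "bij_betw h A B \<Longrightarrow> mean B f = mean A (\<lambda>a. f (h a))"
  by (simp add: mean_def sum.reindex_bij_betw bij_betw_same_card)

lemma mean_square_le:
  assumes "finite A" "A \<noteq> {}"
  shows "(mean A f)\<^sup>2 \<le> mean A (\<lambda>a. (f a)\<^sup>2)"
proof -
  define c where "c = mean A f"
  have "0 \<le> mean A (\<lambda>a. (f a - c)\<^sup>2)"
    by (rule mean_nonneg) simp
  also have "\<dots> = mean A (\<lambda>a. ((f a)\<^sup>2 + c\<^sup>2) - 2 * c * f a)"
    by (simp add: power2_diff algebra_simps)
  also have "\<dots> = mean A (\<lambda>a. (f a)\<^sup>2) - c\<^sup>2"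
    using assms by (simp add: mean_diff mean_add mean_cmult mean_const c_def [symmetric] power2_eq_square)
  finally show ?thesis by (simp add: c_def)
qed

lemma mean_power_le:
  assumes "finite A" "A \<noteq> {}"
  shows "(mean A f) ^ (2 ^ k) \<le> mean A (\<lambda>a. f a ^ (2 ^ k))"
proof (induction k arbitrary: f)
  case (Suc k)
  have "(mean A f) ^ (2 ^ Suc k) = ((mean A f)\<^sup>2) ^ (2 ^ k)"
    by (simp add: power_mult)
  also have "\<dots> \<le> (mean A (\<lambda>a. (f a)\<^sup>2)) ^ (2 ^ k)"
    by (intro power_mono mean_square_le assms) simp
  also have "\<dots> \<le> mean A (\<lambda>a. ((f a)\<^sup>2) ^ (2 ^ k))"
    by (rule Suc)
  finally show ?case by (simp add: power_mult)
qed simp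

lemma bij_betw_PiE_insert:
  assumes "j \<notin> J"
  shows "bij_betw (\<lambda>(z, y). z(j := y)) ((J \<rightarrow>\<^sub>E A) \<times> A) (insert j J \<rightarrow>\<^sub>E A)"
proof (rule bij_betw_byWitness [where f' = "\<lambda>z. (z(j := undefined), z j)"])
  show "\<forall>p\<in>(J \<rightarrow>\<^sub>E A) \<times> A.
      (\<lambda>z. (z(j := undefined), z j)) ((\<lambda>(z, y). z(j := y)) p) = p"
    using assms by (auto simp: fun_eq_iff PiE_def extensional_def)
  show "\<forall>z\<in>insert j J \<rightarrow>\<^sub>E A. (\<lambda>(z, y). z(j := y)) (z(j := undefined), z j) = z"
    by simp
  show "(\<lambda>(z, y). z(j := y)) ` ((J \<rightarrow>\<^sub>E A) \<times> A) \<subseteq> insert j J \<rightarrow>\<^sub>E A"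
    by (auto simp: PiE_def Pi_def extensional_def)
  show "(\<lambda>z. (z(j := undefined), z j)) ` (insert j J \<rightarrow>\<^sub>E A) \<subseteq> (J \<rightarrow>\<^sub>E A) \<times> A"
    using assms by (auto simp: PiE_def Pi_def extensional_def)
qed

lemma mean_PiE_insert:
  assumes "j \<notin> J"
  shows "mean (insert j J \<rightarrow>\<^sub>E A) f = mean (J \<rightarrow>\<^sub>E A) (\<lambda>z. mean A (\<lambda>y. f (z(j := y))))"
proof -
  have "mean (insert j J \<rightarrow>\<^sub>E A) f = mean ((J \<rightarrow>\<^sub>E A) \<times> A) (\<lambda>p. f ((fst p)(j := snd p)))"
    using mean_reindex [OF bij_betw_PiE_insert [OF assms]] by (simp only: split_def)
  then show ?thesis by (simp only: mean_Times)
qed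

section \<open>The Cauchy-Schwarz inequality for boxes\<close>

text \<open>
  \<open>mix \<omega> z z'\<close> is the vertex, on the side of \<open>z'\<close> in the directions of \<open>\<omega>\<close>, of the box that has
  \<open>z\<close> and \<open>z'\<close> as opposite vertices.
\<close>

definition mix :: "nat set \<Rightarrow> (nat \<Rightarrow> 'a) \<Rightarrow> (nat \<Rightarrow> 'a) \<Rightarrow> nat \<Rightarrow> 'a" where
  "mix \<omega> z z' i = (if i \<in> \<omega> then z' i else z i)"

lemma prod_Pow_insert:
  fixes F :: "'a set \<Rightarrow> 'b::comm_monoid_mult"
  assumes "finite S" "j \<notin> S"
  shows "(\<Prod>\<omega>\<in>Pow (insert j S). F \<omega>) = (\<Prod>\<omega>\<in>Pow S. F \<omega> * F (insert j \<omega>))"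
proof -
  have "(\<Prod>\<omega>\<in>Pow (insert j S). F \<omega>) = (\<Prod>\<omega>\<in>Pow S. F \<omega>) * (\<Prod>\<omega>\<in>insert j ` Pow S. F \<omega>)"
    unfolding Pow_insert by (rule prod.union_disjoint) (use assms in auto)
  also have "(\<Prod>\<omega>\<in>insert j ` Pow S. F \<omega>) = (\<Prod>\<omega>\<in>Pow S. F (insert j \<omega>))"
    by (rule prod.reindex_cong [of "insert j"]) (use assms in \<open>auto simp: inj_on_def\<close>)
  finally show ?thesis by (simp add: prod.distrib)
qed

text \<open>
  Every use of the Cauchy-Schwarz inequality removes one of the bounded factors: as a function of the
  \<open>i\<close>-th coordinate alone \<open>B i\<close> is a constant, and squaring the average over that coordinate
  duplicates it.  The induction removes the last coordinate in this way and then treats the product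
  of \<open>G\<close> at two values of that coordinate as a new function \<open>G\<close> of the others.
\<close>

lemma box_cauchy_schwarz:
  fixes G :: "(nat \<Rightarrow> 'a) \<Rightarrow> real"
  assumes A: "finite A" "A \<noteq> {}"
    and "\<And>i z. i < m \<Longrightarrow> z \<in> {..<m} \<rightarrow>\<^sub>E A \<Longrightarrow> \<bar>B i z\<bar> \<le> 1"
    and "\<And>i z y. i < m \<Longrightarrow> z \<in> {..<m} \<rightarrow>\<^sub>E A \<Longrightarrow> y \<in> A \<Longrightarrow> B i (z(i := y)) = B i z"
  shows "(mean ({..<m} \<rightarrow>\<^sub>E A) (\<lambda>z. G z * (\<Prod>i<m. B i z))) ^ (2 ^ m)
    \<le> mean ({..<m} \<rightarrow>\<^sub>E A) (\<lambda>z. mean ({..<m} \<rightarrow>\<^sub>E A) (\<lambda>z'. \<Prod>\<omega>\<in>Pow {..<m}. G (mix \<omega> z z')))"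
  using assms(3,4)
proof (induction m arbitrary: G B)
  case 0
  then show ?case
    by (simp add: mean_def mix_def)
next
  case (Suc m)
  let ?Z = "{..<m} \<rightarrow>\<^sub>E A"
  obtain a where a: "a \<in> A" using A by blast
  have fZ: "finite ?Z" "?Z \<noteq> {}" using A by (auto simp: finite_PiE PiE_eq_empty_iff)
  have upd: "z(m := y) \<in> {..<Suc m} \<rightarrow>\<^sub>E A" if "z \<in> ?Z" "y \<in> A" for z y
    using that by (auto simp: PiE_def Pi_def extensional_def)
  have split: "mean ({..<Suc m} \<rightarrow>\<^sub>E A) f = mean ?Z (\<lambda>z. mean A (\<lambda>y. f (z(m := y))))" for f
    unfolding lessThan_Suc by (rule mean_PiE_insert) simp
  define T where "T z y = G (z(m := y)) * (\<Prod>i<m. B i (z(m := y)))" for z y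
  define b where "b z = B m (z(m := a))" for z
  have b1: "\<bar>b z\<bar> \<le> 1" if "z \<in> ?Z" for z
    unfolding b_def by (rule Suc.prems(1) [OF lessI upd [OF that a]])
  have bm: "B m (z(m := y)) = b z" if "z \<in> ?Z" "y \<in> A" for z y
    unfolding b_def using Suc.prems(2) [OF lessI upd [OF that(1) a] that(2)] by (simp only: fun_upd_upd)
  \<comment> \<open>The two copies of the last coordinate become parameters of the induction hypothesis.\<close>
  define K where "K y y' = mean ?Z (\<lambda>z. T z y * T z y')" for y y'
  define M where "M = mean ({..<Suc m} \<rightarrow>\<^sub>E A) (\<lambda>z. G z * (\<Prod>i<Suc m. B i z))"
  have "M = mean ?Z (\<lambda>z. mean A (\<lambda>y. T z y * b z))"
    unfolding M_def split
    by (intro mean_cong refl) (simp add: T_def bm)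
  also have "\<dots> = mean ?Z (\<lambda>z. mean A (T z) * b z)"
    by (simp add: mean_multc)
  finally have "M\<^sup>2 \<le> mean ?Z (\<lambda>z. (mean A (T z) * b z)\<^sup>2)"
    using mean_square_le [OF fZ] by simp
  also have "\<dots> \<le> mean ?Z (\<lambda>z. (mean A (T z))\<^sup>2)"
  proof (rule mean_mono)
    fix z assume "z \<in> ?Z"
    then have "(b z)\<^sup>2 \<le> 1" using b1 by (simp add: abs_square_le_1)
    then show "(mean A (T z) * b z)\<^sup>2 \<le> (mean A (T z))\<^sup>2"
      using mult_left_mono [of "(b z)\<^sup>2" 1 "(mean A (T z))\<^sup>2"] by (simp add: power_mult_distrib)
  qed
  also have "\<dots> = mean ?Z (\<lambda>z. mean A (\<lambda>y. mean A (\<lambda>y'. T z y * T z y')))"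
    by (simp add: power2_eq_square mean_multc mean_cmult)
  also have "\<dots> = mean A (\<lambda>y. mean A (\<lambda>y'. K y y'))"
    unfolding K_def by (subst mean_commute, intro mean_cong refl, subst mean_commute) simp
  also have "\<dots> = mean (A \<times> A) (\<lambda>p. K (fst p) (snd p))"
    by (rule mean_Times)
  finally have M2: "M\<^sup>2 \<le> mean (A \<times> A) (\<lambda>p. K (fst p) (snd p))" .
  let ?box = "\<lambda>z z' y y'. \<Prod>\<omega>\<in>Pow {..<m}. G ((mix \<omega> z z')(m := y)) * G ((mix \<omega> z z')(m := y'))"
  have K: "K y y' ^ (2 ^ m) \<le> mean ?Z (\<lambda>z. mean ?Z (\<lambda>z'. ?box z z' y y'))"
    if y: "y \<in> A" "y' \<in> A" for y y'
  proof -
    have K_eq: "K y y' = mean ?Z (\<lambda>z. (G (z(m := y)) * G (z(m := y'))) *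
        (\<Prod>i<m. B i (z(m := y)) * B i (z(m := y'))))"
      unfolding K_def T_def by (intro mean_cong refl) (simp add: prod.distrib mult_ac)
    show ?thesis
      unfolding K_eq
    proof (rule Suc.IH [where G = "\<lambda>z. G (z(m := y)) * G (z(m := y'))"
          and B = "\<lambda>i z. B i (z(m := y)) * B i (z(m := y'))"])
      fix i z assume iz: "i < m" "z \<in> ?Z"
      have "\<bar>B i (z(m := y))\<bar> \<le> 1" "\<bar>B i (z(m := y'))\<bar> \<le> 1"
        using Suc.prems(1) [OF less_SucI [OF iz(1)] upd [OF iz(2)]] y by blast+
      then show "\<bar>B i (z(m := y)) * B i (z(m := y'))\<bar> \<le> 1"
        by (simp add: abs_mult mult_le_one)
    next
      fix i z t assume iz: "i < m" "z \<in> ?Z" and t: "t \<in> A"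
      have "B i (z(i := t, m := x)) = B i (z(m := x))" if "x \<in> A" for x
        using Suc.prems(2) [OF less_SucI [OF iz(1)] upd [OF iz(2) that] t]
        by (simp only: fun_upd_twist [OF less_imp_neq [OF iz(1)]])
      from this [OF y(1)] this [OF y(2)]
      have e: "B i (z(i := t, m := y)) * B i (z(i := t, m := y')) = B i (z(m := y)) * B i (z(m := y'))"
        by (rule arg_cong2)
      show "B i (z(i := t, m := y)) * B i (z(i := t, m := y')) = B i (z(m := y)) * B i (z(m := y'))"
        by (rule e)
    qed
  qed
  have "M ^ (2 ^ Suc m) = (M\<^sup>2) ^ (2 ^ m)"
    by (simp add: power_mult)
  also have "\<dots> \<le> (mean (A \<times> A) (\<lambda>p. K (fst p) (snd p))) ^ (2 ^ m)"
    by (intro power_mono M2) simp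
  also have "\<dots> \<le> mean (A \<times> A) (\<lambda>p. K (fst p) (snd p) ^ (2 ^ m))"
    by (rule mean_power_le) (use A in auto)
  also have "\<dots> \<le> mean (A \<times> A) (\<lambda>p. mean ?Z (\<lambda>z. mean ?Z (\<lambda>z'. ?box z z' (fst p) (snd p))))"
    by (intro mean_mono K) auto
  also have "\<dots> = mean A (\<lambda>y. mean A (\<lambda>y'. mean ?Z (\<lambda>z. mean ?Z (\<lambda>z'. ?box z z' y y'))))"
    by (rule mean_Times [symmetric])
  also have "\<dots> = mean A (\<lambda>y. mean ?Z (\<lambda>z. mean ?Z (\<lambda>z'. mean A (\<lambda>y'. ?box z z' y y'))))"
    by (intro mean_cong refl, subst mean_commute, intro mean_cong refl, rule mean_commute)
  also have "\<dots> = mean ?Z (\<lambda>z. mean A (\<lambda>y. mean ?Z (\<lambda>z'. mean A (\<lambda>y'. ?box z z' y y'))))"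
    by (rule mean_commute)
  also have "\<dots> = mean ({..<Suc m} \<rightarrow>\<^sub>E A) (\<lambda>z. mean ({..<Suc m} \<rightarrow>\<^sub>E A)
      (\<lambda>z'. \<Prod>\<omega>\<in>Pow {..<Suc m}. G (mix \<omega> z z')))"
  proof -
    have "?box z z' y y' = (\<Prod>\<omega>\<in>Pow {..<Suc m}. G (mix \<omega> (z(m := y)) (z'(m := y'))))" for z z' y y'
    proof -
      have "(mix \<omega> z z')(m := y) = mix \<omega> (z(m := y)) (z'(m := y'))"
        "(mix \<omega> z z')(m := y') = mix (insert m \<omega>) (z(m := y)) (z'(m := y'))"
        if "\<omega> \<in> Pow {..<m}" for \<omega>
        using that by (auto simp: fun_eq_iff mix_def)
      then show ?thesis
        unfolding lessThan_Suc by (subst prod_Pow_insert) (auto intro!: prod.cong)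
    qed
    then show ?thesis unfolding split by simp
  qed
  finally show ?case unfolding M_def .
qed

section \<open>Gowers norms of real functions\<close>

locale finite_abelian_group = abelian_group V
  for V :: "('k, 'v) module" (structure) +
  assumes finite_carrier: "finite (carrier V)"
begin

lemma carrier_nonempty: "carrier V \<noteq> {}"
  using zero_closed by blast

lemma finsum_PiE_closed:
  assumes "z \<in> J \<rightarrow>\<^sub>E carrier V" "S \<subseteq> J"
  shows "finsum V z S \<in> carrier V"
  by (intro finsum_closed Pi_I PiE_mem [OF assms(1)]) (use assms(2) in blast)

lemma finsum_if_add:
  assumes "finite S" "\<omega> \<subseteq> S" "c \<in> S \<rightarrow> carrier V" "d \<in> \<omega> \<rightarrow> carrier V"
  shows "(\<Oplus>i\<in>S. if i \<in> \<omega> then c i \<oplus> d i else c i) = finsum V c S \<oplus> finsum V d \<omega>"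
proof -
  have "(\<Oplus>i\<in>S. if i \<in> \<omega> then c i \<oplus> d i else c i) = (\<Oplus>i\<in>S. c i \<oplus> (if i \<in> \<omega> then d i else \<zero>))"
    by (rule finsum_cong') (use assms in \<open>auto simp: Pi_iff\<close>)
  also have "\<dots> = finsum V c S \<oplus> (\<Oplus>i\<in>S. if i \<in> \<omega> then d i else \<zero>)"
    by (rule finsum_addf) (use assms in \<open>auto simp: Pi_iff\<close>)
  also have "(\<Oplus>i\<in>S. if i \<in> \<omega> then d i else \<zero>) = finsum V d \<omega>"
    by (rule add.finprod_mono_neutral_cong_right) (use assms in \<open>auto simp: Pi_iff\<close>)
  finally show ?thesis .
qed

lemma bij_betw_translate:
  assumes "s \<in> carrier V"
  shows "bij_betw (\<lambda>y. s \<oplus> y) (carrier V) (carrier V)"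
  by (rule bij_betw_byWitness [where f' = "\<lambda>y. (\<ominus> s) \<oplus> y"])
    (use assms in \<open>auto simp: a_assoc [symmetric] l_neg r_neg\<close>)

text \<open>
  A sum of independent uniformly distributed elements is uniformly distributed as soon as it has a
  summand: the last coordinate alone already makes it so.
\<close>

lemma mean_translated_sum:
  fixes m :: nat
  assumes "a \<in> carrier V" "m \<ge> 1"
  shows "mean ({..<m} \<rightarrow>\<^sub>E carrier V) (\<lambda>z. \<Phi> (a \<oplus> finsum V z {..<m})) = mean (carrier V) \<Phi>"
proof -
  obtain k where m: "m = Suc k" using assms by (cases m) auto
  let ?Z = "{..<k} \<rightarrow>\<^sub>E carrier V"
  have "mean ({..<m} \<rightarrow>\<^sub>E carrier V) (\<lambda>z. \<Phi> (a \<oplus> finsum V z {..<m}))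
      = mean ?Z (\<lambda>z. mean (carrier V) (\<lambda>y. \<Phi> (a \<oplus> finsum V (z(k := y)) (insert k {..<k}))))"
    unfolding m lessThan_Suc by (rule mean_PiE_insert) simp
  also have "\<dots> = mean ?Z (\<lambda>z. mean (carrier V) \<Phi>)"
  proof (rule mean_cong [OF refl])
    fix z assume z: "z \<in> ?Z"
    let ?s = "finsum V z {..<k}"
    have s: "?s \<in> carrier V"
      by (rule finsum_PiE_closed [OF z]) simp
    have "a \<oplus> finsum V (z(k := y)) (insert k {..<k}) = (a \<oplus> ?s) \<oplus> y" if y: "y \<in> carrier V" for y
    proof -
      have "finsum V (z(k := y)) {..<k} = ?s"
        by (rule finsum_cong') (use z in auto)
      moreover have "finsum V (z(k := y)) (insert k {..<k}) = y \<oplus> finsum V (z(k := y)) {..<k}"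
        by (subst finsum_insert) (use z y in \<open>auto simp: Pi_iff PiE_iff\<close>)
      ultimately show ?thesis using assms s y by (simp add: a_ac)
    qed
    then have "mean (carrier V) (\<lambda>y. \<Phi> (a \<oplus> finsum V (z(k := y)) (insert k {..<k})))
        = mean (carrier V) (\<lambda>y. \<Phi> ((a \<oplus> ?s) \<oplus> y))"
      by (intro mean_cong refl) simp
    also have "\<dots> = mean (carrier V) \<Phi>"
      by (rule mean_reindex [symmetric, OF bij_betw_translate]) (use assms s in simp)
    finally show "mean (carrier V) (\<lambda>y. \<Phi> (a \<oplus> finsum V (z(k := y)) (insert k {..<k})))
        = mean (carrier V) \<Phi>" .
  qed
  also have "\<dots> = mean (carrier V) \<Phi>"
    by (rule mean_const)
      (use finite_carrier carrier_nonempty in \<open>auto simp: finite_PiE PiE_eq_empty_iff\<close>)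
  finally show ?thesis .
qed

definition gowers_mean :: "nat \<Rightarrow> ('v \<Rightarrow> real) \<Rightarrow> real" where
  "gowers_mean m g = mean (carrier V) (\<lambda>x. mean ({..<m} \<rightarrow>\<^sub>E carrier V)
     (\<lambda>v. \<Prod>\<omega>\<in>Pow {..<m}. g (cube_vertex V x v \<omega>)))"

lemma gowers_norm_of_real:
  "gowers_norm V m (\<lambda>x. complex_of_real (g x)) = root (2 ^ m) (gowers_mean m g)"
proof -
  let ?D = "carrier V \<times> ({..<m} \<rightarrow>\<^sub>E carrier V)"
  have "(\<Prod>\<omega>\<in>Pow {..<m}. if even (card \<omega>) then complex_of_real (g (cube_vertex V x v \<omega>))
      else cnj (complex_of_real (g (cube_vertex V x v \<omega>))))
    = complex_of_real (\<Prod>\<omega>\<in>Pow {..<m}. g (cube_vertex V x v \<omega>))" for x v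
    by (simp cong: if_cong)
  then have "average ?D (\<lambda>(x, v). \<Prod>\<omega>\<in>Pow {..<m}.
        if even (card \<omega>) then complex_of_real (g (cube_vertex V x v \<omega>))
        else cnj (complex_of_real (g (cube_vertex V x v \<omega>))))
      = complex_of_real (mean ?D (\<lambda>p. \<Prod>\<omega>\<in>Pow {..<m}. g (cube_vertex V (fst p) (snd p) \<omega>)))"
    by (simp add: average_def mean_def split_def)
  then show ?thesis
    by (simp add: gowers_norm_def gowers_mean_def mean_Times)
qed

text \<open>
  Writing \<open>z' = z + v\<close> turns the vertices of the box into those of the cube with base point
  \<open>a + (\<Sum>i<m. z i)\<close> and directions \<open>v\<close>, and this base point is uniformly distributed.
\<close>

lemma box_mean_eq_gowers_mean:
  assumes "a \<in> carrier V" "m \<ge> 1"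
  shows "mean ({..<m} \<rightarrow>\<^sub>E carrier V) (\<lambda>z. mean ({..<m} \<rightarrow>\<^sub>E carrier V)
      (\<lambda>z'. \<Prod>\<omega>\<in>Pow {..<m}. g (a \<oplus> finsum V (mix \<omega> z z') {..<m}))) = gowers_mean m g"
proof -
  let ?Z = "{..<m} \<rightarrow>\<^sub>E carrier V"
  define Q where "Q = (\<lambda>x. mean ?Z (\<lambda>v. \<Prod>\<omega>\<in>Pow {..<m}. g (cube_vertex V x v \<omega>)))"
  let ?P = "\<lambda>x v. \<Prod>\<omega>\<in>Pow {..<m}. g (cube_vertex V x v \<omega>)"
  have "mean ?Z (\<lambda>z'. \<Prod>\<omega>\<in>Pow {..<m}. g (a \<oplus> finsum V (mix \<omega> z z') {..<m}))
      = mean ?Z (\<lambda>v. ?P (a \<oplus> finsum V z {..<m}) v)" if z: "z \<in> ?Z" for z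
  proof -
    have "bij_betw (\<lambda>v. \<lambda>i\<in>{..<m}. z i \<oplus> v i) ?Z ?Z"
      by (rule bij_betw_byWitness [where f' = "\<lambda>v. \<lambda>i\<in>{..<m}. \<ominus> z i \<oplus> v i"])
        (use z in \<open>auto simp: fun_eq_iff a_assoc [symmetric] l_neg r_neg PiE_iff extensional_def\<close>)
    then have "mean ?Z (\<lambda>z'. \<Prod>\<omega>\<in>Pow {..<m}. g (a \<oplus> finsum V (mix \<omega> z z') {..<m}))
      = mean ?Z (\<lambda>v. \<Prod>\<omega>\<in>Pow {..<m}. g (a \<oplus> finsum V (mix \<omega> z (\<lambda>i\<in>{..<m}. z i \<oplus> v i)) {..<m}))"
      by (rule mean_reindex)
    also have "\<dots> = mean ?Z (\<lambda>v. ?P (a \<oplus> finsum V z {..<m}) v)"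
    proof (intro mean_cong refl prod.cong)
      fix v \<omega> assume v: "v \<in> ?Z" and \<omega>: "\<omega> \<in> Pow {..<m}"
      have "finsum V (mix \<omega> z (\<lambda>i\<in>{..<m}. z i \<oplus> v i)) {..<m}
          = (\<Oplus>i\<in>{..<m}. if i \<in> \<omega> then z i \<oplus> v i else z i)"
        by (rule finsum_cong') (use z v \<omega> in \<open>auto simp: mix_def PiE_iff Pi_iff\<close>)
      also have "\<dots> = finsum V z {..<m} \<oplus> finsum V v \<omega>"
        by (rule finsum_if_add) (use z v \<omega> in \<open>auto simp: PiE_iff Pi_iff\<close>)
      finally have *: "finsum V (mix \<omega> z (\<lambda>i\<in>{..<m}. z i \<oplus> v i)) {..<m}
          = finsum V z {..<m} \<oplus> finsum V v \<omega>" .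
      have "finsum V z {..<m} \<in> carrier V" "finsum V v \<omega> \<in> carrier V"
        using finsum_PiE_closed [OF z] finsum_PiE_closed [OF v] \<omega> by simp_all
      then show "g (a \<oplus> finsum V (mix \<omega> z (\<lambda>i\<in>{..<m}. z i \<oplus> v i)) {..<m})
          = g (cube_vertex V (a \<oplus> finsum V z {..<m}) v \<omega>)"
        unfolding * cube_vertex_def using assms by (simp add: a_assoc)
    qed
    finally show ?thesis .
  qed
  then have "mean ?Z (\<lambda>z. mean ?Z (\<lambda>z'. \<Prod>\<omega>\<in>Pow {..<m}. g (a \<oplus> finsum V (mix \<omega> z z') {..<m})))
      = mean ?Z (\<lambda>z. Q (a \<oplus> finsum V z {..<m}))"
    unfolding Q_def by (rule mean_cong [OF refl])
  also have "\<dots> = mean (carrier V) Q"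
    by (rule mean_translated_sum [OF assms])
  finally show ?thesis
    unfolding gowers_mean_def Q_def [symmetric] .
qed

end

section \<open>Resampling and the generalized von Neumann inequality\<close>

definition override :: "(nat \<Rightarrow> 'j) \<Rightarrow> nat \<Rightarrow> ('j \<Rightarrow> 'a) \<Rightarrow> (nat \<Rightarrow> 'a) \<Rightarrow> 'j \<Rightarrow> 'a" where
  "override e m r z = (\<lambda>p. if p \<in> e ` {..<m} then z (the_inv_into {..<m} e p) else r p)"

lemma override_apply: "inj_on e {..<m} \<Longrightarrow> i < m \<Longrightarrow> override e m r z (e i) = z i"
  by (simp add: override_def the_inv_into_f_f)

lemma override_other: "p \<notin> e ` {..<m} \<Longrightarrow> override e m r z p = r p"
  by (simp add: override_def)

lemma override_in_PiE:
  assumes "inj_on e {..<m}" "e ` {..<m} \<subseteq> J" "r \<in> J \<rightarrow>\<^sub>E A" "z \<in> {..<m} \<rightarrow>\<^sub>E A"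
  shows "override e m r z \<in> J \<rightarrow>\<^sub>E A"
proof (rule PiE_I)
  fix p assume "p \<in> J"
  show "override e m r z p \<in> A"
  proof (cases "p \<in> e ` {..<m}")
    case True
    then obtain i where "p = e i" "i < m" by auto
    then show ?thesis using assms by (auto simp: override_apply)
  qed (use assms \<open>p \<in> J\<close> in \<open>auto simp: override_other\<close>)
next
  fix p assume "p \<notin> J"
  then have "p \<notin> e ` {..<m}" using assms by blast
  then show "override e m r z p = undefined"
    using assms \<open>p \<notin> J\<close> by (auto simp: override_other PiE_iff extensional_def)
qed

lemma override_upd:
  assumes "inj_on e {..<m}" "i < m"
  shows "override e m r (z(i := y)) = (override e m r z)(e i := y)"
proof
  fix p
  show "override e m r (z(i := y)) p = ((override e m r z)(e i := y)) p"
  proof (cases "p \<in> e ` {..<m}")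
    case True
    then obtain k where "p = e k" "k < m" by auto
    then show ?thesis using assms by (simp add: override_apply inj_on_eq_iff)
  next
    case False
    then show ?thesis using assms by (auto simp: override_other)
  qed
qed

text \<open>
  Exchanging the coordinates \<open>e i\<close> of \<open>r\<close> with those of \<open>z\<close> is an involution of the set of pairs
  \<open>(r, z)\<close>, so the altered point is distributed like \<open>r\<close>.
\<close>

lemma mean_resample:
  assumes e: "inj_on e {..<m}" "e ` {..<m} \<subseteq> J" and A: "finite A" "A \<noteq> {}"
  shows "mean (J \<rightarrow>\<^sub>E A) \<Phi> = mean (J \<rightarrow>\<^sub>E A) (\<lambda>r. mean ({..<m} \<rightarrow>\<^sub>E A) (\<lambda>z. \<Phi> (override e m r z)))"
proof -
  let ?Z = "{..<m} \<rightarrow>\<^sub>E A"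
  let ?swap = "\<lambda>(r, z). (override e m r z, \<lambda>i\<in>{..<m}. r (e i))"
  have mem: "?swap p \<in> (J \<rightarrow>\<^sub>E A) \<times> ?Z" if pin: "p \<in> (J \<rightarrow>\<^sub>E A) \<times> ?Z" for p
  proof -
    obtain r z where p: "r \<in> J \<rightarrow>\<^sub>E A" "z \<in> ?Z" "p = (r, z)"
      using pin by (rule SigmaE)
    have "(\<lambda>i\<in>{..<m}. r (e i)) \<in> ?Z"
      unfolding restrict_PiE_iff using PiE_mem [OF p(1)] e(2) by blast
    then show ?thesis
      using override_in_PiE [OF e p(1,2)] by (simp add: p(3))
  qed
  have invol: "?swap (?swap p) = p" if pin: "p \<in> (J \<rightarrow>\<^sub>E A) \<times> ?Z" for p
  proof -
    obtain r z where p: "r \<in> J \<rightarrow>\<^sub>E A" "z \<in> ?Z" "p = (r, z)"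
      using pin by (rule SigmaE)
    have "override e m (override e m r z) (\<lambda>i\<in>{..<m}. r (e i)) q = r q" for q
    proof (cases "q \<in> e ` {..<m}")
      case True
      then obtain k where "q = e k" "k < m" by auto
      then show ?thesis using e by (simp add: override_apply)
    qed (simp add: override_other)
    moreover have "(\<lambda>i\<in>{..<m}. override e m r z (e i)) = z"
      by (rule extensionalityI [of _ "{..<m}"])
        (use p(2) e in \<open>auto simp: override_apply PiE_iff\<close>)
    ultimately show ?thesis by (auto simp: p(3))
  qed
  have bij: "bij_betw ?swap ((J \<rightarrow>\<^sub>E A) \<times> ?Z) ((J \<rightarrow>\<^sub>E A) \<times> ?Z)"
    by (rule bij_betw_byWitness [where f' = ?swap]) (intro ballI image_subsetI mem invol; assumption)+
  have "mean (J \<rightarrow>\<^sub>E A) \<Phi> = mean (J \<rightarrow>\<^sub>E A) (\<lambda>r. mean ?Z (\<lambda>z. \<Phi> r))"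
    by (subst mean_const) (use A in \<open>auto simp: finite_PiE PiE_eq_empty_iff\<close>)
  also have "\<dots> = mean ((J \<rightarrow>\<^sub>E A) \<times> ?Z) (\<lambda>p. \<Phi> (fst p))"
    by (rule mean_Times)
  also have "\<dots> = mean ((J \<rightarrow>\<^sub>E A) \<times> ?Z) (\<lambda>p. \<Phi> (override e m (fst p) (snd p)))"
    by (subst mean_reindex [OF bij]) (simp add: split_def)
  also have "\<dots> = mean (J \<rightarrow>\<^sub>E A) (\<lambda>r. mean ?Z (\<lambda>z. \<Phi> (override e m r z)))"
    by (rule mean_Times [symmetric])
  finally show ?thesis .
qed

context finite_abelian_group
begin

lemma finsum_override:
  assumes e: "inj_on e {..<m}" "e ` {..<m} \<subseteq> S" and S: "finite S" "S \<subseteq> J"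
    and r: "r \<in> J \<rightarrow>\<^sub>E carrier V" and z: "z \<in> {..<m} \<rightarrow>\<^sub>E carrier V"
  shows "finsum V (override e m r z) S = finsum V r (S - e ` {..<m}) \<oplus> finsum V z {..<m}"
proof -
  let ?o = "override e m r z" and ?E = "e ` {..<m}"
  have o: "?o \<in> J \<rightarrow>\<^sub>E carrier V"
    by (rule override_in_PiE [OF e(1) _ r z]) (use e S in blast)
  have oS: "?o p \<in> carrier V" if "p \<in> S" for p
    using PiE_mem [OF o] S that by blast
  have rS: "r p \<in> carrier V" if "p \<in> S" for p
    using PiE_mem [OF r] S that by blast
  have zm: "z i \<in> carrier V" if "i < m" for i
    using PiE_mem [OF z] that by blast
  have "finsum V ?o ((S - ?E) \<union> ?E) = finsum V ?o (S - ?E) \<oplus> finsum V ?o ?E"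
    by (rule finsum_Un_disjoint) (use oS e S in \<open>auto simp: finite_subset\<close>)
  also have "(S - ?E) \<union> ?E = S" using e by blast
  also have "finsum V ?o (S - ?E) = finsum V r (S - ?E)"
    by (rule finsum_cong') (use rS in \<open>auto simp: override_other\<close>)
  also have "finsum V ?o ?E = (\<Oplus>i\<in>{..<m}. ?o (e i))"
    by (rule finsum_reindex) (use oS e in auto)
  also have "\<dots> = finsum V z {..<m}"
    by (rule finsum_cong') (use zm e in \<open>auto simp: override_apply\<close>)
  finally show ?thesis .
qed

text \<open>
  Fix all coordinates but those in the range of \<open>e\<close>.  As a function of these \<open>m\<close> coordinates the
  form is their sum up to a constant, and each \<open>b s\<close> is independent of one of them.  Grouping the
  \<open>b s\<close> by this coordinate produces the situation of \<open>box_cauchy_schwarz\<close>.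
\<close>

lemma generalized_von_neumann:
  assumes m: "m \<ge> 1" and I: "finite I" and y: "y \<in> carrier V"
    and e: "inj_on e {..<m}" "e ` {..<m} \<subseteq> S" and S: "finite S" "S \<subseteq> J" and J: "finite J"
    and b1: "\<And>s r. s \<in> I \<Longrightarrow> r \<in> J \<rightarrow>\<^sub>E carrier V \<Longrightarrow> \<bar>b s r\<bar> \<le> 1"
    and b: "\<And>s. s \<in> I \<Longrightarrow> \<exists>i<m. \<forall>r\<in>J \<rightarrow>\<^sub>E carrier V. \<forall>x\<in>carrier V. b s (r(e i := x)) = b s r"
  shows "\<bar>mean (J \<rightarrow>\<^sub>E carrier V) (\<lambda>r. g (y \<oplus> finsum V r S) * (\<Prod>s\<in>I. b s r))\<bar>
    \<le> root (2 ^ m) (gowers_mean m g)"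
proof -
  let ?A = "carrier V" and ?Z = "{..<m} \<rightarrow>\<^sub>E carrier V" and ?R = "J \<rightarrow>\<^sub>E carrier V"
  have R: "finite ?R" "?R \<noteq> {}"
    using J finite_carrier carrier_nonempty by (auto simp: finite_PiE PiE_eq_empty_iff)
  have eJ: "e ` {..<m} \<subseteq> J" using e S by blast
  obtain \<kappa> where \<kappa>: "\<And>s. s \<in> I \<Longrightarrow> \<kappa> s < m"
    "\<And>s r x. s \<in> I \<Longrightarrow> r \<in> ?R \<Longrightarrow> x \<in> ?A \<Longrightarrow> b s (r(e (\<kappa> s) := x)) = b s r"
    using b by metis
  let ?\<Phi> = "\<lambda>r. g (y \<oplus> finsum V r S) * (\<Prod>s\<in>I. b s r)"
  have inner: "(mean ?Z (\<lambda>z. ?\<Phi> (override e m r z))) ^ (2 ^ m) \<le> gowers_mean m g"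
    if r: "r \<in> ?R" for r
  proof -
    define a where "a = y \<oplus> finsum V r (S - e ` {..<m})"
    have rS: "finsum V r (S - e ` {..<m}) \<in> ?A"
      by (rule finsum_PiE_closed [OF r]) (use S in blast)
    then have a: "a \<in> ?A" using y by (simp add: a_def)
    define B where "B i z = (\<Prod>s\<in>{s \<in> I. \<kappa> s = i}. b s (override e m r z))" for i z
    have o: "override e m r z \<in> ?R" if "z \<in> ?Z" for z
      by (rule override_in_PiE [OF e(1) eJ r that])
    have eq: "?\<Phi> (override e m r z) = g (a \<oplus> finsum V z {..<m}) * (\<Prod>i<m. B i z)"
      if z: "z \<in> ?Z" for z
    proof -
      have "(\<Prod>i<m. B i z) = (\<Prod>s\<in>I. b s (override e m r z))"
        unfolding B_def by (rule prod.group) (use I \<kappa>(1) in auto)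
      moreover have "finsum V z {..<m} \<in> ?A"
        by (rule finsum_PiE_closed [OF z]) simp
      ultimately show ?thesis
        using y rS by (simp add: finsum_override [OF e S r z] a_def a_assoc)
    qed
    have "mean ?Z (\<lambda>z. ?\<Phi> (override e m r z))
        = mean ?Z (\<lambda>z. g (a \<oplus> finsum V z {..<m}) * (\<Prod>i<m. B i z))"
      by (rule mean_cong [OF refl]) (rule eq)
    then have "(mean ?Z (\<lambda>z. ?\<Phi> (override e m r z))) ^ (2 ^ m)
        = (mean ?Z (\<lambda>z. g (a \<oplus> finsum V z {..<m}) * (\<Prod>i<m. B i z))) ^ (2 ^ m)"
      by (rule arg_cong)
    also have "\<dots> \<le> mean ?Z (\<lambda>z. mean ?Z
        (\<lambda>z'. \<Prod>\<omega>\<in>Pow {..<m}. g (a \<oplus> finsum V (mix \<omega> z z') {..<m})))"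
    proof (rule box_cauchy_schwarz [OF finite_carrier carrier_nonempty])
      fix i z assume iz: "i < m" "z \<in> ?Z"
      have "\<bar>b s (override e m r z)\<bar> \<le> 1" if "s \<in> I" for s
        by (rule b1 [OF that o [OF iz(2)]])
      then show "\<bar>B i z\<bar> \<le> 1"
        unfolding B_def abs_prod by (intro prod_le_1) auto
    next
      fix i z x assume iz: "i < m" "z \<in> ?Z" and x: "x \<in> ?A"
      have "b s ((override e m r z)(e i := x)) = b s (override e m r z)"
        if "s \<in> {s \<in> I. \<kappa> s = i}" for s
        using \<kappa>(2) [of s "override e m r z" x] that o [OF iz(2)] x by fast
      then show "B i (z(i := x)) = B i z"
        unfolding B_def override_upd [OF e(1) iz(1)] by (rule prod.cong [OF refl])
    qed
    also have "\<dots> = gowers_mean m g"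
      by (rule box_mean_eq_gowers_mean [OF a m])
    finally show ?thesis .
  qed
  let ?M = "mean ?R ?\<Phi>"
  have "?M = mean ?R (\<lambda>r. mean ?Z (\<lambda>z. ?\<Phi> (override e m r z)))"
    by (rule mean_resample [OF e(1) eJ finite_carrier carrier_nonempty])
  then have "?M ^ (2 ^ m) = (mean ?R (\<lambda>r. mean ?Z (\<lambda>z. ?\<Phi> (override e m r z)))) ^ (2 ^ m)"
    by (rule arg_cong)
  also have "\<dots> \<le> mean ?R (\<lambda>r. (mean ?Z (\<lambda>z. ?\<Phi> (override e m r z))) ^ (2 ^ m))"
    by (rule mean_power_le [OF R])
  also have "\<dots> \<le> mean ?R (\<lambda>r. gowers_mean m g)"
    by (rule mean_mono) (rule inner)
  also have "\<dots> = gowers_mean m g" by (rule mean_const [OF R])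
  finally have "\<bar>?M\<bar> ^ (2 ^ m) \<le> gowers_mean m g"
    using m by (simp add: power_even_abs)
  then have "root (2 ^ m) (\<bar>?M\<bar> ^ (2 ^ m)) \<le> root (2 ^ m) (gowers_mean m g)"
    by simp
  then show ?thesis by (simp add: real_root_power_cancel)
qed

end

section \<open>Counting linear forms in a uniform set\<close>

context abelian_monoid
begin

text \<open>
  Iterated sums, as needed both in \<open>V\<close>, to regroup the variables of a configuration, and in \<open>H\<close>, to
  interchange two alternating sums.
\<close>

lemma finsum_Times:
  assumes "finite A" "finite B" "\<And>a b. a \<in> A \<Longrightarrow> b \<in> B \<Longrightarrow> f (a, b) \<in> carrier G"
  shows "finsum G f (A \<times> B) = (\<Oplus>a\<in>A. \<Oplus>b\<in>B. f (a, b))"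
proof -
  have "A \<times> B = (\<Union>a\<in>A. Pair a ` B)" by auto
  then have "finsum G f (A \<times> B) = (\<Oplus>a\<in>A. finsum G f (Pair a ` B))"
    by (simp only:) (rule add.finprod_UN_disjoint,
      use assms in \<open>auto simp: pairwise_def disjnt_def\<close>)
  also have "\<dots> = (\<Oplus>a\<in>A. \<Oplus>b\<in>B. f (a, b))"
  proof (rule finsum_cong' [OF refl])
    show "(\<lambda>a. \<Oplus>b\<in>B. f (a, b)) \<in> A \<rightarrow> carrier G"
      by (intro Pi_I finsum_closed) (use assms in auto)
    show "finsum G f (Pair a ` B) = (\<Oplus>b\<in>B. f (a, b))" if "a \<in> A" for a
      by (rule finsum_reindex) (use assms that in \<open>auto simp: inj_on_def\<close>)
  qed
  finally show ?thesis .
qed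

lemma finsum_swap:
  assumes "finite A" "finite B" "\<And>a b. a \<in> A \<Longrightarrow> b \<in> B \<Longrightarrow> f a b \<in> carrier G"
  shows "(\<Oplus>a\<in>A. \<Oplus>b\<in>B. f a b) = (\<Oplus>b\<in>B. \<Oplus>a\<in>A. f a b)"
proof -
  have "(\<Oplus>a\<in>A. \<Oplus>b\<in>B. f a b) = finsum G (case_prod f) (A \<times> B)"
    by (subst finsum_Times) (use assms in auto)
  also have "A \<times> B = prod.swap ` (B \<times> A)" by auto
  also have "finsum G (case_prod f) (prod.swap ` (B \<times> A)) = (\<Oplus>p\<in>B \<times> A. case_prod f (prod.swap p))"
    by (rule finsum_reindex) (use assms in \<open>auto intro: inj_onI\<close>)
  also have "\<dots> = (\<Oplus>b\<in>B. \<Oplus>a\<in>A. f a b)"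
    by (subst finsum_Times) (use assms in auto)
  finally show ?thesis .
qed

end

context finite_abelian_group
begin

lemma mean_over_form:
  fixes e :: "nat \<Rightarrow> 'j"
  assumes m: "m \<ge> 1" and y: "y \<in> carrier V"
    and e: "inj_on e {..<m}" "e ` {..<m} \<subseteq> S" and S: "S \<subseteq> J" and J: "finite J"
  shows "mean (J \<rightarrow>\<^sub>E carrier V) (\<lambda>r. \<Phi> (y \<oplus> finsum V r S)) = mean (carrier V) \<Phi>"
proof -
  let ?Z = "{..<m} \<rightarrow>\<^sub>E carrier V" and ?R = "J \<rightarrow>\<^sub>E carrier V"
  have fS: "finite S" using S J by (rule finite_subset)
  have "mean ?R (\<lambda>r. \<Phi> (y \<oplus> finsum V r S))
      = mean ?R (\<lambda>r. mean ?Z (\<lambda>z. \<Phi> (y \<oplus> finsum V (override e m r z) S)))"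
    by (rule mean_resample [OF e(1) _ finite_carrier carrier_nonempty]) (use e S in blast)
  also have "\<dots> = mean ?R (\<lambda>r. mean (carrier V) \<Phi>)"
  proof (rule mean_cong [OF refl])
    fix r assume r: "r \<in> ?R"
    define a where "a = y \<oplus> finsum V r (S - e ` {..<m})"
    have rS: "finsum V r (S - e ` {..<m}) \<in> carrier V"
      by (rule finsum_PiE_closed [OF r]) (use S in blast)
    then have a: "a \<in> carrier V" using y by (simp add: a_def)
    have "y \<oplus> finsum V (override e m r z) S = a \<oplus> finsum V z {..<m}" if z: "z \<in> ?Z" for z
      using y rS finsum_PiE_closed [OF z subset_refl]
      by (simp add: finsum_override [OF e fS S r z] a_def a_assoc)
    then have "mean ?Z (\<lambda>z. \<Phi> (y \<oplus> finsum V (override e m r z) S))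
        = mean ?Z (\<lambda>z. \<Phi> (a \<oplus> finsum V z {..<m}))"
      by (intro mean_cong [OF refl] arg_cong [where f = \<Phi>])
    then show "mean ?Z (\<lambda>z. \<Phi> (y \<oplus> finsum V (override e m r z) S)) = mean (carrier V) \<Phi>"
      by (simp only: mean_translated_sum [OF a m])
  qed
  also have "\<dots> = mean (carrier V) \<Phi>"
    by (rule mean_const)
      (use J finite_carrier carrier_nonempty in \<open>simp_all add: finite_PiE PiE_eq_empty_iff\<close>)
  finally show ?thesis .
qed

lemma density_eq_mean:
  assumes "X \<subseteq> carrier V"
  shows "density V X = mean (carrier V) (indicator X)"
proof -
  have "(\<Sum>x\<in>carrier V. indicator X x) = real (card X)"
    using assms finite_carrier by (simp add: indicator_def sum.If_cases Int_absorb1)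
  then show ?thesis by (simp add: density_def mean_def)
qed

lemma density_le_1:
  assumes "X \<subseteq> carrier V" shows "density V X \<le> 1"
  using card_mono [OF finite_carrier assms] by (auto simp: density_def divide_le_eq_1)

text \<open>
  Forms are added in order of increasing rank, so that \<open>sep\<close> provides the coordinates for
  \<open>generalized_von_neumann\<close> when the indicator at the newest form is compared with the density.
  The first bound uses this comparison at every step; the second one is the union bound, which is
  better for densities close to 1.
\<close>

lemma counting_lower_bounds:
  fixes y :: "'t \<Rightarrow> 'v" and S :: "'t \<Rightarrow> 'j set" and rank :: "'t \<Rightarrow> nat"
  assumes m: "m \<ge> 1" and I: "finite I" and J: "finite J" and X: "X \<subseteq> carrier V"
    and y: "\<And>t. t \<in> I \<Longrightarrow> y t \<in> carrier V"
    and S: "\<And>t. t \<in> I \<Longrightarrow> S t \<subseteq> J"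
    and e: "\<And>t. t \<in> I \<Longrightarrow> inj_on (e t) {..<m}" "\<And>t. t \<in> I \<Longrightarrow> e t ` {..<m} \<subseteq> S t"
    and sep: "\<And>t s. t \<in> I \<Longrightarrow> s \<in> I \<Longrightarrow> s \<noteq> t \<Longrightarrow> rank s \<le> rank t \<Longrightarrow> \<exists>i<m. e t i \<notin> S s"
    and \<eta>: "gowers_norm V m (\<lambda>x. indicator X x - complex_of_real (density V X)) \<le> \<eta>" "0 \<le> \<eta>"
  defines "c \<equiv> \<lambda>I'. mean (J \<rightarrow>\<^sub>E carrier V)
      (\<lambda>r. \<Prod>t\<in>I'. indicator X (y t \<oplus> finsum V r (S t)))"
  shows "density V X ^ card I - real (card I) * \<eta> \<le> c I"
    and "1 - real (card I) * (1 - density V X) \<le> c I"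
proof -
  let ?R = "J \<rightarrow>\<^sub>E carrier V"
  define \<alpha> where "\<alpha> = density V X"
  define \<phi> where "\<phi> t r = y t \<oplus> finsum V r (S t)" for t r
  define P where "P I' r = (\<Prod>t\<in>I'. indicator X (\<phi> t r) :: real)" for I' r
  have R: "finite ?R" "?R \<noteq> {}"
    using J finite_carrier carrier_nonempty by (simp_all add: finite_PiE PiE_eq_empty_iff)
  have c: "c I' = mean ?R (P I')" for I'
    unfolding c_def P_def \<phi>_def ..
  have \<alpha>: "0 \<le> \<alpha>" "\<alpha> \<le> 1"
    using density_le_1 [OF X] by (simp_all add: \<alpha>_def density_def)
  have gowers: "root (2 ^ m) (gowers_mean m (\<lambda>x. indicator X x - \<alpha>)) \<le> \<eta>"
  proof -
    have "(\<lambda>x. indicator X x - complex_of_real (density V X))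
        = (\<lambda>x. complex_of_real (indicator X x - \<alpha>))"
      by (simp add: \<alpha>_def indicator_def fun_eq_iff)
    then show ?thesis using \<eta>(1) by (simp only: gowers_norm_of_real)
  qed
  have P01: "0 \<le> P I' r" "P I' r \<le> 1" for I' r
    unfolding P_def by (auto intro!: prod_nonneg prod_le_1 simp: indicator_def)
  have "I' \<subseteq> I \<longrightarrow> \<alpha> ^ card I' - real (card I') * \<eta> \<le> c I' \<and> 1 - real (card I') * (1 - \<alpha>) \<le> c I'"
    if "finite I'" for I'
    using that
  proof (induction I' rule: finite_ranking_induct [where f = rank])
    case empty
    have "P {} = (\<lambda>r. 1)" by (simp add: P_def fun_eq_iff)
    then show ?case by (simp add: c mean_const [OF R])
  next
    case (insert t I')
    show ?case
    proof (cases "t \<in> I'")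
      case True
      then show ?thesis using insert by (simp add: insert_absorb)
    next
      case t: False
      show ?thesis
      proof
        assume sub: "insert t I' \<subseteq> I"
        then have tI: "t \<in> I" and I'I: "I' \<subseteq> I" by auto
        have IH: "\<alpha> ^ card I' - real (card I') * \<eta> \<le> c I'" "1 - real (card I') * (1 - \<alpha>) \<le> c I'"
          using insert.IH I'I by auto
        have ins: "P (insert t I') r = indicator X (\<phi> t r) * P I' r" for r
          unfolding P_def using insert.hyps(1) t by simp
        have "\<bar>mean ?R (\<lambda>r. (indicator X (y t \<oplus> finsum V r (S t)) - \<alpha>) *
            (\<Prod>s\<in>I'. indicator X (\<phi> s r)))\<bar> \<le> root (2 ^ m) (gowers_mean m (\<lambda>x. indicator X x - \<alpha>))"
        proof (rule generalized_von_neumann [OF m insert.hyps(1) y [OF tI] e(1) [OF tI] e(2) [OF tI]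
              finite_subset [OF S [OF tI] J] S [OF tI] J, where g = "\<lambda>x. indicator X x - \<alpha>"])
          show "\<bar>indicator X (\<phi> s r)\<bar> \<le> (1 :: real)" for s r
            by (simp add: indicator_def)
          fix s assume s: "s \<in> I'"
          then have sI: "s \<in> I" using I'I by blast
          have "s \<noteq> t" using s t by blast
          moreover have "rank s \<le> rank t" using insert.hyps(2) s by blast
          ultimately obtain i where i: "i < m" "e t i \<notin> S s" using sep tI sI by blast
          have "\<phi> s (r(e t i := x)) = \<phi> s r" if r: "r \<in> ?R" for r x
          proof -
            have "r p \<in> carrier V" if "p \<in> S s" for p
              using PiE_mem [OF r] S [OF sI] that by blast
            then have "finsum V (r(e t i := x)) (S s) = finsum V r (S s)"
              by (intro finsum_cong' refl) (use i(2) in auto)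
            then show ?thesis by (simp add: \<phi>_def)
          qed
          then show "\<exists>i<m. \<forall>r\<in>?R. \<forall>x\<in>carrier V.
              indicator X (\<phi> s (r(e t i := x))) = (indicator X (\<phi> s r) :: real)"
            using i(1) by auto
        qed
        then have "- \<eta> \<le> mean ?R (\<lambda>r. (indicator X (\<phi> t r) - \<alpha>) * P I' r)"
          using gowers by (simp add: \<phi>_def P_def)
        also have "\<dots> = c (insert t I') - \<alpha> * c I'"
          unfolding c ins by (simp add: left_diff_distrib mean_diff mean_cmult)
        finally have "\<alpha> * c I' - \<eta> \<le> c (insert t I')" by simp
        moreover have "\<alpha> * (\<alpha> ^ card I' - real (card I') * \<eta>) \<le> \<alpha> * c I'"
          using IH(1) \<alpha>(1) by (rule mult_left_mono)
        moreover have "\<alpha> * (real (card I') * \<eta>) \<le> 1 * (real (card I') * \<eta>)"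
          using \<alpha>(2) \<eta>(2) by (intro mult_right_mono) auto
        ultimately have 1: "\<alpha> ^ card (insert t I') - real (card (insert t I')) * \<eta> \<le> c (insert t I')"
          using insert.hyps(1) t by (simp add: algebra_simps)
        \<comment> \<open>The union bound: adding one condition loses at most the density of the complement of \<open>X\<close>.\<close>
        have "c I' - (1 - \<alpha>) = mean ?R (P I') - mean ?R (\<lambda>r. 1 - indicator X (\<phi> t r))"
        proof -
          have "mean ?R (\<lambda>r. indicator X (\<phi> t r)) = \<alpha>"
            unfolding \<phi>_def \<alpha>_def density_eq_mean [OF X]
            by (rule mean_over_form [OF m y [OF tI] e(1) [OF tI] e(2) [OF tI] S [OF tI] J])
          then show ?thesis by (simp add: c mean_diff mean_const [OF R])
        qed
        also have "\<dots> = mean ?R (\<lambda>r. P I' r - (1 - indicator X (\<phi> t r)))"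
          by (rule mean_diff [symmetric])
        also have "\<dots> \<le> mean ?R (P (insert t I'))"
        proof (rule mean_mono)
          fix r
          show "P I' r - (1 - indicator X (\<phi> t r)) \<le> P (insert t I') r"
            using P01 [of I' r] by (cases "\<phi> t r \<in> X") (auto simp: ins)
        qed
        finally have "c I' - (1 - \<alpha>) \<le> c (insert t I')" by (simp only: c)
        then have 2: "1 - real (card (insert t I')) * (1 - \<alpha>) \<le> c (insert t I')"
          using IH(2) insert.hyps(1) t by (simp add: algebra_simps)
        show "\<alpha> ^ card (insert t I') - real (card (insert t I')) * \<eta> \<le> c (insert t I') \<and>
            1 - real (card (insert t I')) * (1 - \<alpha>) \<le> c (insert t I')"
          using 1 2 by blast
      qed
    qed
  qed
  from this [OF I] show "density V X ^ card I - real (card I) * \<eta> \<le> c I"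
    "1 - real (card I) * (1 - density V X) \<le> c I"
    by (simp_all add: \<alpha>_def)
qed

end

text \<open>
  For \<open>\<delta>\<close> bounded away from 1 a fixed number of further factors \<open>\<delta>\<close> outweighs the constant \<open>N\<close>.  The
  bound \<open>1 - 1 / N\<close> is the point from which on the union bound for \<open>N\<close> conditions is effective.
\<close>

lemma polynomial_smallness_exists:
  fixes N :: nat
  shows "\<exists>C. \<forall>\<delta>::real. 0 < \<delta> \<longrightarrow> \<delta> \<le> 1 - 1 / real N \<longrightarrow> real N * \<delta> ^ C \<le> \<delta> ^ N"
proof (cases "N = 0")
  case False
  define q where "q = 1 - 1 / real N"
  have "q < 1" using False by (simp add: q_def)
  then obtain K where K: "q ^ K < 1 / real N"
    using real_arch_pow_inv [of "1 / real N" q] False by auto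
  have "real N * \<delta> ^ (N + K) \<le> \<delta> ^ N" if \<delta>: "0 < \<delta>" "\<delta> \<le> q" for \<delta> :: real
  proof -
    have "\<delta> ^ K \<le> 1 / real N"
      using power_mono [OF \<delta>(2), of K] \<delta>(1) K by simp
    then have "real N * \<delta> ^ K \<le> 1" using False by (simp add: field_simps)
    then have "\<delta> ^ N * (real N * \<delta> ^ K) \<le> \<delta> ^ N * 1"
      using \<delta>(1) by (intro mult_left_mono) auto
    then show ?thesis by (simp add: power_add mult_ac)
  qed
  then show ?thesis unfolding q_def by blast
qed auto

context finite_abelian_group
begin

lemma forms_meet_uniform_subset:
  fixes y :: "'t \<Rightarrow> 'v" and S :: "'t \<Rightarrow> 'j set" and rank :: "'t \<Rightarrow> nat"
  assumes m: "m \<ge> 1" and I: "finite I" and J: "finite J"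
    and y: "\<And>t. t \<in> I \<Longrightarrow> y t \<in> carrier V"
    and S: "\<And>t. t \<in> I \<Longrightarrow> S t \<subseteq> J"
    and e: "\<And>t. t \<in> I \<Longrightarrow> inj_on (e t) {..<m}" "\<And>t. t \<in> I \<Longrightarrow> e t ` {..<m} \<subseteq> S t"
    and sep: "\<And>t s. t \<in> I \<Longrightarrow> s \<in> I \<Longrightarrow> s \<noteq> t \<Longrightarrow> rank s \<le> rank t \<Longrightarrow> \<exists>i<m. e t i \<notin> S s"
    and C: "\<delta> \<le> 1 - 1 / real (card I) \<longrightarrow> real (card I) * \<delta> ^ C \<le> \<delta> ^ card I"
    and \<delta>: "0 < \<delta>" and dens: "\<delta> < density V X" and unif: "uniform_subset V (\<delta> ^ C) m X"
  obtains r where "r \<in> J \<rightarrow>\<^sub>E carrier V" "\<And>t. t \<in> I \<Longrightarrow> y t \<oplus> finsum V r (S t) \<in> X"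
proof -
  let ?R = "J \<rightarrow>\<^sub>E carrier V"
  let ?P = "\<lambda>r. \<Prod>t\<in>I. indicator X (y t \<oplus> finsum V r (S t)) :: real"
  let ?N = "real (card I)"
  have X: "X \<subseteq> carrier V"
    and \<eta>: "gowers_norm V m (\<lambda>x. indicator X x - complex_of_real (density V X)) \<le> \<delta> ^ C"
    using unif by (auto simp: uniform_subset_def)
  have low: "density V X ^ card I - ?N * \<delta> ^ C \<le> mean ?R ?P"
    "1 - ?N * (1 - density V X) \<le> mean ?R ?P"
    using \<delta> by (intro counting_lower_bounds [OF m I J X y S e sep \<eta>]; simp)+
  have "0 < mean ?R ?P"
  proof (cases "I = {}")
    case True
    then show ?thesis using low(2) by simp
  next
    case False
    then have N: "0 < ?N" using I by (simp add: card_gt_0_iff)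
    show ?thesis
    proof (cases "\<delta> \<le> 1 - 1 / ?N")
      case True
      have "\<delta> ^ card I < density V X ^ card I"
        using \<delta> dens N by (intro power_strict_mono) auto
      then show ?thesis using C True low(1) by linarith
    next
      case False
      then have "1 - density V X < 1 / ?N" using dens by linarith
      then have "?N * (1 - density V X) < 1" using N by (simp add: field_simps)
      then show ?thesis using low(2) by linarith
    qed
  qed
  then have "\<exists>r\<in>?R. ?P r \<noteq> 0"
    by (metis (no_types, lifting) mean_def div_0 less_irrefl sum.neutral)
  then obtain r where r: "r \<in> ?R" "?P r \<noteq> 0" by blast
  have "y t \<oplus> finsum V r (S t) \<in> X" if "t \<in> I" for t
    using r(2) I that by (auto simp: prod_zero_iff indicator_def)
  then show ?thesis using r(1) that by blast
qed

end

section \<open>Affine families of corners\<close>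

definition configuration_index :: "nat \<Rightarrow> (nat set \<times> (nat \<Rightarrow> nat)) set" where
  "configuration_index m = (Pow {..<m} - {{}}) \<times> ({..<m} \<rightarrow>\<^sub>E {..<3})"

lemma finite_configuration_index: "finite (configuration_index m)"
  by (simp add: configuration_index_def finite_PiE)

context finite_abelian_group
begin

text \<open>
  The forms are ranked by the cardinality of \<open>\<eta>\<close>.  A form \<open>(\<eta>', \<omega>')\<close> of rank not above that of
  \<open>(\<eta>, \<omega>)\<close> either has \<open>\<eta>' = \<eta>\<close> and a letter different from \<open>\<omega> i\<close> at some \<open>i\<close>, or its \<open>\<eta>'\<close> omits
  some \<open>i \<in> \<eta>\<close>.  In both cases it is free of the \<open>i\<close>-th of the \<open>m\<close> variables chosen for \<open>(\<eta>, \<omega>)\<close>.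
\<close>

lemma configuration_exists:
  fixes y :: "(nat \<Rightarrow> nat) \<Rightarrow> 'v"
  assumes m: "m \<ge> 1"
    and y: "\<And>\<omega>. \<omega> \<in> {..<m} \<rightarrow>\<^sub>E {..<3} \<Longrightarrow> y \<omega> \<in> carrier V"
    and C: "\<delta> \<le> 1 - 1 / real (card (configuration_index m)) \<longrightarrow>
      real (card (configuration_index m)) * \<delta> ^ C \<le> \<delta> ^ card (configuration_index m)"
    and \<delta>: "0 < \<delta>" and dens: "\<delta> < density V X" and unif: "uniform_subset V (\<delta> ^ C) m X"
  obtains r :: "nat \<Rightarrow> nat \<Rightarrow> nat \<Rightarrow> 'v" where
    "\<And>i \<tau> j. i < m \<Longrightarrow> \<tau> < 3 \<Longrightarrow> j < m \<Longrightarrow> r i \<tau> j \<in> carrier V"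
    "\<And>\<omega> \<eta>. \<omega> \<in> {..<m} \<rightarrow>\<^sub>E {..<3} \<Longrightarrow> \<eta> \<subseteq> {..<m} \<Longrightarrow> \<eta> \<noteq> {} \<Longrightarrow>
      y \<omega> \<oplus> (\<Oplus>i\<in>{..<m}. \<Oplus>j\<in>\<eta>. r i (\<omega> i) j) \<in> X"
proof -
  let ?I = "configuration_index m"
  define J :: "(nat \<times> nat \<times> nat) set" where "J = {..<m} \<times> {..<3} \<times> {..<m}"
  define S :: "nat set \<times> (nat \<Rightarrow> nat) \<Rightarrow> (nat \<times> nat \<times> nat) set" where
    "S t = (\<lambda>(i, j). (i, snd t i, j)) ` ({..<m} \<times> fst t)" for t
  \<comment> \<open>One variable per position \<open>i\<close>, so that a change of the letter there is noticed; its last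
    index is \<open>i\<close> if possible, so that the absence of \<open>i\<close> from \<open>\<eta>'\<close> is noticed too.\<close>
  define e :: "nat set \<times> (nat \<Rightarrow> nat) \<Rightarrow> nat \<Rightarrow> nat \<times> nat \<times> nat" where
    "e t i = (i, snd t i, if i \<in> fst t then i else (SOME j. j \<in> fst t))" for t i
  have index: "fst t \<subseteq> {..<m}" "fst t \<noteq> {}" "snd t \<in> {..<m} \<rightarrow>\<^sub>E {..<3}" if "t \<in> ?I" for t
    using that by (simp_all add: configuration_index_def mem_Times_iff)
  have SJ: "S t \<subseteq> J" if t: "t \<in> ?I" for t
    using index(1) [OF t] PiE_mem [OF index(3) [OF t]] by (fastforce simp: S_def J_def)
  have "finite J" by (simp add: J_def)
  obtain r where r: "r \<in> J \<rightarrow>\<^sub>E carrier V"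
    and rX: "\<And>t. t \<in> ?I \<Longrightarrow> y (snd t) \<oplus> finsum V r (S t) \<in> X"
  proof (rule forms_meet_uniform_subset [OF m finite_configuration_index [of m] \<open>finite J\<close> _ SJ,
        where y = "\<lambda>t. y (snd t)" and e = e and rank = "\<lambda>t. card (fst t)" and \<delta> = \<delta> and C = C and X = X])
    fix t assume t: "t \<in> ?I"
    show "y (snd t) \<in> carrier V" by (rule y [OF index(3) [OF t]])
    show "inj_on (e t) {..<m}" by (simp add: e_def inj_on_def)
    have "(SOME j. j \<in> fst t) \<in> fst t" using index(2) [OF t] by (simp add: some_in_eq)
    then show "e t ` {..<m} \<subseteq> S t" by (auto simp: e_def S_def image_iff)
    fix s assume s: "s \<in> ?I" and ne: "s \<noteq> t" and rank: "card (fst s) \<le> card (fst t)"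
    show "\<exists>i<m. e t i \<notin> S s"
    proof (cases "fst s = fst t")
      case True
      then have "snd s \<noteq> snd t" using ne by (simp add: prod_eq_iff)
      then obtain i where "i < m" "snd s i \<noteq> snd t i"
        using PiE_ext [OF index(3) [OF s] index(3) [OF t]] by blast
      then show ?thesis by (auto simp: e_def S_def)
    next
      case False
      have "\<not> fst t \<subseteq> fst s"
        using card_seteq [of "fst s" "fst t"] rank False finite_subset [OF index(1) [OF s]] by auto
      then obtain i where "i \<in> fst t" "i \<notin> fst s" by blast
      then show ?thesis using index(1) [OF t] by (auto simp: e_def S_def)
    qed
  qed (use C \<delta> dens unif in blast)+
  define r' where "r' i \<tau> j = r (i, \<tau>, j)" for i \<tau> j
  have closed: "r' i \<tau> j \<in> carrier V" if "i < m" "\<tau> < 3" "j < m" for i \<tau> j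
    unfolding r'_def by (rule PiE_mem [OF r]) (use that in \<open>simp add: J_def\<close>)
  have "y \<omega> \<oplus> (\<Oplus>i\<in>{..<m}. \<Oplus>j\<in>\<eta>. r' i (\<omega> i) j) \<in> X"
    if \<omega>: "\<omega> \<in> {..<m} \<rightarrow>\<^sub>E {..<3}" and \<eta>: "\<eta> \<subseteq> {..<m}" "\<eta> \<noteq> {}" for \<omega> \<eta>
  proof -
    have I: "(\<eta>, \<omega>) \<in> ?I" using \<omega> \<eta> by (simp add: configuration_index_def)
    have \<omega>3: "\<omega> i < 3" if "i < m" for i using PiE_mem [OF \<omega>, of i] that by simp
    have mem: "r (i, \<omega> i, j) \<in> carrier V" if "i < m" "j \<in> \<eta>" for i j
      using closed [of i "\<omega> i" j] \<omega>3 that \<eta>(1) by (auto simp: r'_def)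
    have "finsum V r (S (\<eta>, \<omega>)) = (\<Oplus>p\<in>{..<m} \<times> \<eta>. r (case p of (i, j) \<Rightarrow> (i, \<omega> i, j)))"
      unfolding S_def fst_conv snd_conv
      by (rule finsum_reindex) (use mem in \<open>auto simp: inj_on_def\<close>)
    also have "\<dots> = (\<Oplus>i\<in>{..<m}. \<Oplus>j\<in>\<eta>. r (i, \<omega> i, j))"
      by (subst finsum_Times) (use mem finite_subset [OF \<eta>(1)] in auto)
    finally show ?thesis using rX [OF I] by (simp add: r'_def)
  qed
  then show ?thesis using that closed by blast
qed

end

definition signed :: "'h ring \<Rightarrow> nat set \<Rightarrow> 'h \<Rightarrow> 'h" where
  "signed H \<omega> a = (if even (card \<omega>) then a else \<ominus>\<^bsub>H\<^esub> a)"

context abelian_group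
begin

lemma finsum_minus:
  assumes "g \<in> A \<rightarrow> carrier G"
  shows "(\<Oplus>a\<in>A. \<ominus> g a) = \<ominus> (finsum G g A)"
proof (rule minus_equality [symmetric])
  have "(\<Oplus>a\<in>A. \<ominus> g a) \<oplus> finsum G g A = (\<Oplus>a\<in>A. \<ominus> g a \<oplus> g a)"
    by (rule finsum_addf [symmetric]) (use assms in auto)
  also have "\<dots> = \<zero>"
    by (rule add.finprod_one_eqI) (use assms in \<open>auto simp: l_neg Pi_iff\<close>)
  finally show "(\<Oplus>a\<in>A. \<ominus> g a) \<oplus> finsum G g A = \<zero>" .
qed (use assms in \<open>auto simp: Pi_iff intro!: finsum_closed\<close>)

end

locale cube_functions = finite_abelian_group V + H: abelian_group H
  for V :: "('k, 'v) module" (structure) and H :: "'h ring" +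
  fixes m :: nat and X :: "'v set" and f :: "'v \<Rightarrow> 'h"
  assumes X: "X \<subseteq> carrier V" and f: "\<And>x. x \<in> X \<Longrightarrow> f x \<in> carrier H"
    and cubes_zero: "\<And>c. c \<in> cubes V m X \<Longrightarrow> cube_sum V H m f c = \<zero>\<^bsub>H\<^esub>"
begin

lemma signed_closed: "a \<in> carrier H \<Longrightarrow> signed H \<omega> a \<in> carrier H"
  by (simp add: signed_def)

lemma signed_commute: "a \<in> carrier H \<Longrightarrow> signed H \<omega> (signed H \<eta> a) = signed H \<eta> (signed H \<omega> a)"
  by (simp add: signed_def)

lemma signed_minus: "a \<in> carrier H \<Longrightarrow> signed H \<omega> (\<ominus>\<^bsub>H\<^esub> a) = \<ominus>\<^bsub>H\<^esub> (signed H \<omega> a)"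
  by (simp add: signed_def)

lemma signed_finsum:
  assumes "\<And>a. a \<in> A \<Longrightarrow> g a \<in> carrier H"
  shows "signed H \<omega> (finsum H g A) = (\<Oplus>\<^bsub>H\<^esub>a\<in>A. signed H \<omega> (g a))"
  using H.finsum_minus [of g A] assms by (auto simp: signed_def)

lemma cube_sum_signed:
  "cube_sum V H m g (u, v) = (\<Oplus>\<^bsub>H\<^esub>\<omega>\<in>Pow {..<m}. signed H \<omega> (g (cube_vertex V u v \<omega>)))"
  by (simp add: cube_sum_def signed_def)

lemma finsum_Pow_split:
  assumes "\<And>\<omega>. \<omega> \<subseteq> {..<m} \<Longrightarrow> g \<omega> \<in> carrier H"
  shows "finsum H g (Pow {..<m}) = g {} \<oplus>\<^bsub>H\<^esub> finsum H g (Pow {..<m} - {{}})"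
proof -
  have "Pow {..<m} = insert {} (Pow {..<m} - {{}})" by auto
  then have "finsum H g (Pow {..<m}) = finsum H g (insert {} (Pow {..<m} - {{}}))"
    by (rule arg_cong)
  also have "\<dots> = g {} \<oplus>\<^bsub>H\<^esub> finsum H g (Pow {..<m} - {{}})"
    by (rule H.finsum_insert) (use assms in auto)
  finally show ?thesis .
qed

text \<open>
  A function of \<open>\<omega>\<close> of the form \<open>x + (\<Sum>i<m. c (i, \<omega> i))\<close> parametrizes the vertices of an \<open>m\<close>-cube,
  with directions \<open>c (i, 1) - c (i, 0)\<close>; this is how all the cubes below arise.
\<close>

lemma alternating_sum_zero:
  assumes x: "x \<in> carrier V" and c: "\<And>i. i < m \<Longrightarrow> c0 i \<in> carrier V" "\<And>i. i < m \<Longrightarrow> c1 i \<in> carrier V"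
    and q: "\<And>\<omega>. \<omega> \<subseteq> {..<m} \<Longrightarrow> q \<omega> = x \<oplus> (\<Oplus>i\<in>{..<m}. if i \<in> \<omega> then c1 i else c0 i)"
    and qX: "\<And>\<omega>. \<omega> \<subseteq> {..<m} \<Longrightarrow> q \<omega> \<in> X"
  shows "(\<Oplus>\<^bsub>H\<^esub>\<omega>\<in>Pow {..<m}. signed H \<omega> (f (q \<omega>))) = \<zero>\<^bsub>H\<^esub>"
proof -
  define u where "u = x \<oplus> finsum V c0 {..<m}"
  define v where "v = (\<lambda>i\<in>{..<m}. c1 i \<ominus> c0 i)"
  have u: "u \<in> carrier V" using x c by (simp add: u_def Pi_iff)
  have v: "v i \<in> carrier V" if "i < m" for i using c that by (simp add: v_def)
  have vertex: "cube_vertex V u v \<omega> = q \<omega>" if \<omega>: "\<omega> \<subseteq> {..<m}" for \<omega>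
  proof -
    have "(\<Oplus>i\<in>{..<m}. if i \<in> \<omega> then c1 i else c0 i) = (\<Oplus>i\<in>{..<m}. if i \<in> \<omega> then c0 i \<oplus> v i else c0 i)"
    proof (rule finsum_cong' [OF refl])
      show "(\<lambda>i. if i \<in> \<omega> then c0 i \<oplus> v i else c0 i) \<in> {..<m} \<rightarrow> carrier V"
        using c v by auto
      have "c0 i \<oplus> (c1 i \<ominus> c0 i) = c1 i" if "i < m" for i
        using c that by (simp add: minus_eq a_lcomm [of "c0 i"] r_neg)
      then show "(if i \<in> \<omega> then c1 i else c0 i) = (if i \<in> \<omega> then c0 i \<oplus> v i else c0 i)"
        if "i \<in> {..<m}" for i
        using that by (simp add: v_def)
    qed
    also have "\<dots> = finsum V c0 {..<m} \<oplus> finsum V v \<omega>"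
      by (rule finsum_if_add) (use c v \<omega> in auto)
    finally have "q \<omega> = x \<oplus> (finsum V c0 {..<m} \<oplus> finsum V v \<omega>)"
      using q [OF \<omega>] by simp
    moreover have "finsum V c0 {..<m} \<in> carrier V" "finsum V v \<omega> \<in> carrier V"
      by (rule finsum_closed, use c v \<omega> in auto)+
    ultimately show ?thesis
      using x by (simp add: cube_vertex_def u_def a_assoc)
  qed
  have "v \<in> {..<m} \<rightarrow>\<^sub>E carrier V"
    unfolding v_def restrict_PiE_iff using c by simp
  then have "(u, v) \<in> cubes V m X"
    using u vertex qX by (simp add: cubes_def)
  then have "\<zero>\<^bsub>H\<^esub> = cube_sum V H m f (u, v)" by (rule cubes_zero [symmetric])
  also have "\<dots> = (\<Oplus>\<^bsub>H\<^esub>\<omega>\<in>Pow {..<m}. signed H \<omega> (f (q \<omega>)))"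
    unfolding cube_sum_signed
    by (rule H.finsum_cong') (use vertex qX f in \<open>auto intro!: signed_closed\<close>)
  finally show ?thesis ..
qed

definition corner :: "'v \<Rightarrow> (nat \<Rightarrow> 'v) \<Rightarrow> bool" where
  "corner x p \<longleftrightarrow> (\<forall>j<m. p j \<in> carrier V) \<and>
     (\<forall>\<eta>\<subseteq>{..<m}. \<eta> \<noteq> {} \<longrightarrow> cube_vertex V x p \<eta> \<in> X)"

text \<open>
  The only value at \<open>x\<close> for which the alternating sum over the cube \<open>(x|p)\<close> vanishes.
\<close>

definition corner_value :: "'v \<Rightarrow> (nat \<Rightarrow> 'v) \<Rightarrow> 'h" where
  "corner_value x p = \<ominus>\<^bsub>H\<^esub> (\<Oplus>\<^bsub>H\<^esub>\<eta>\<in>Pow {..<m} - {{}}. signed H \<eta> (f (cube_vertex V x p \<eta>)))"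

lemma corner_sum_closed:
  assumes "corner x p"
  shows "(\<Oplus>\<^bsub>H\<^esub>\<eta>\<in>Pow {..<m} - {{}}. signed H \<eta> (f (cube_vertex V x p \<eta>))) \<in> carrier H"
  by (rule H.finsum_closed) (use assms in \<open>auto simp: corner_def intro!: signed_closed f\<close>)

lemma corner_value_closed: "corner x p \<Longrightarrow> corner_value x p \<in> carrier H"
  unfolding corner_value_def by (intro H.a_inv_closed corner_sum_closed)

lemma corner_value_eq:
  assumes "x \<in> X" "corner x p"
  shows "corner_value x p = f x"
proof -
  have x: "x \<in> carrier V" using assms X by blast
  have p: "p j \<in> carrier V" if "j < m" for j using assms that by (simp add: corner_def)
  have v0: "cube_vertex V x p {} = x" using x by (simp add: cube_vertex_def)
  have inX: "cube_vertex V x p \<eta> \<in> X" if "\<eta> \<subseteq> {..<m}" for \<eta>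
    using that assms v0 by (cases "\<eta> = {}") (auto simp: corner_def)
  have "(\<Oplus>\<^bsub>H\<^esub>\<eta>\<in>Pow {..<m}. signed H \<eta> (f (cube_vertex V x p \<eta>))) = \<zero>\<^bsub>H\<^esub>"
  proof (rule alternating_sum_zero [OF x])
    fix \<omega> :: "nat set" assume \<omega>: "\<omega> \<subseteq> {..<m}"
    have "(\<Oplus>i\<in>{..<m}. if i \<in> \<omega> then p i else \<zero>) = finsum V p \<omega>"
      by (rule add.finprod_mono_neutral_cong_right) (use p \<omega> in auto)
    then show "cube_vertex V x p \<omega> = x \<oplus> (\<Oplus>i\<in>{..<m}. if i \<in> \<omega> then p i else \<zero>)"
      by (simp add: cube_vertex_def)
  qed (use p inX in auto)
  also have "(\<Oplus>\<^bsub>H\<^esub>\<eta>\<in>Pow {..<m}. signed H \<eta> (f (cube_vertex V x p \<eta>)))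
      = f x \<oplus>\<^bsub>H\<^esub> (\<Oplus>\<^bsub>H\<^esub>\<eta>\<in>Pow {..<m} - {{}}. signed H \<eta> (f (cube_vertex V x p \<eta>)))"
    by (subst finsum_Pow_split) (use inX f in \<open>auto simp: v0 signed_def\<close>)
  finally show ?thesis
    unfolding corner_value_def
    by (intro H.minus_equality) (use assms f corner_sum_closed in auto)
qed

text \<open>
  A corner that depends on the vertex \<open>\<omega>\<close> of a cube in an affine way: moving in direction \<open>i\<close>
  replaces the \<open>i\<close>-th summand.
\<close>

definition interpolate :: "(nat \<Rightarrow> nat \<Rightarrow> 'v) \<Rightarrow> (nat \<Rightarrow> nat \<Rightarrow> 'v) \<Rightarrow> nat set \<Rightarrow> nat \<Rightarrow> 'v" where
  "interpolate a0 a1 \<omega> j = (\<Oplus>i\<in>{..<m}. if i \<in> \<omega> then a1 i j else a0 i j)"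

lemma cube_vertex_interpolate:
  assumes "\<And>i j. i < m \<Longrightarrow> j < m \<Longrightarrow> a0 i j \<in> carrier V" "\<And>i j. i < m \<Longrightarrow> j < m \<Longrightarrow> a1 i j \<in> carrier V"
    and "\<eta> \<subseteq> {..<m}"
  shows "cube_vertex V x (interpolate a0 a1 \<omega>) \<eta>
    = x \<oplus> (\<Oplus>i\<in>{..<m}. \<Oplus>j\<in>\<eta>. if i \<in> \<omega> then a1 i j else a0 i j)"
  unfolding cube_vertex_def interpolate_def
  by (subst finsum_swap) (use assms finite_subset [OF assms(3)] in \<open>auto simp: subset_iff\<close>)

definition corner_family ::
    "'v \<Rightarrow> (nat \<Rightarrow> 'v) \<Rightarrow> (nat \<Rightarrow> nat \<Rightarrow> 'v) \<Rightarrow> (nat \<Rightarrow> nat \<Rightarrow> 'v) \<Rightarrow> bool" where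
  "corner_family x u a0 a1 \<longleftrightarrow>
     (\<forall>i<m. \<forall>j<m. a0 i j \<in> carrier V \<and> a1 i j \<in> carrier V) \<and>
     (\<forall>\<omega>\<subseteq>{..<m}. corner (cube_vertex V x u \<omega>) (interpolate a0 a1 \<omega>))"

lemma corner_family_corner:
  "corner_family x u a0 a1 \<Longrightarrow> \<omega> \<subseteq> {..<m} \<Longrightarrow>
    corner (cube_vertex V x u \<omega>) (interpolate a0 a1 \<omega>)"
  by (simp add: corner_family_def)

text \<open>
  The values are double alternating sums, over \<open>\<omega>\<close> and over nonempty \<open>\<eta>\<close>, of \<open>f\<close> at the points
  \<open>q \<omega> \<eta>\<close>.  By the affine dependence on \<open>\<omega>\<close> these points form an \<open>m\<close>-cube in \<open>X\<close> for fixed \<open>\<eta>\<close>, so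
  summation over \<open>\<omega>\<close> first gives zero.
\<close>

lemma corner_values_alternating_sum:
  assumes x: "x \<in> carrier V" and u: "\<And>i. i < m \<Longrightarrow> u i \<in> carrier V"
    and family: "corner_family x u a0 a1"
  shows "(\<Oplus>\<^bsub>H\<^esub>\<omega>\<in>Pow {..<m}. signed H \<omega> (corner_value (cube_vertex V x u \<omega>) (interpolate a0 a1 \<omega>)))
    = \<zero>\<^bsub>H\<^esub>"
proof -
  define q where "q \<omega> \<eta> = cube_vertex V (cube_vertex V x u \<omega>) (interpolate a0 a1 \<omega>) \<eta>" for \<omega> \<eta>
  have a: "a0 i j \<in> carrier V" "a1 i j \<in> carrier V" if "i < m" "j < m" for i j
    using family that by (auto simp: corner_family_def)
  let ?P = "Pow {..<m}" and ?P' = "Pow {..<m} - {{}}"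
  have qX: "q \<omega> \<eta> \<in> X" if "\<omega> \<in> ?P" "\<eta> \<in> ?P'" for \<omega> \<eta>
    using corner_family_corner [OF family, of \<omega>] that by (auto simp: corner_def q_def)
  have fq: "f (q \<omega> \<eta>) \<in> carrier H" if "\<omega> \<in> ?P" "\<eta> \<in> ?P'" for \<omega> \<eta>
    using f qX that by blast
  have zero: "(\<Oplus>\<^bsub>H\<^esub>\<omega>\<in>?P. signed H \<omega> (f (q \<omega> \<eta>))) = \<zero>\<^bsub>H\<^esub>" if \<eta>: "\<eta> \<in> ?P'" for \<eta>
  proof (rule alternating_sum_zero [OF x])
    define A0 where "A0 i = (\<Oplus>j\<in>\<eta>. a0 i j)" for i
    define A1 where "A1 i = (\<Oplus>j\<in>\<eta>. a1 i j)" for i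
    have A: "A0 i \<in> carrier V" "A1 i \<in> carrier V" if "i < m" for i
      unfolding A0_def A1_def by (intro finsum_closed Pi_I a; use \<eta> that in blast)+
    show "A0 i \<in> carrier V" if "i < m" for i using A that by simp
    show "u i \<oplus> A1 i \<in> carrier V" if "i < m" for i using A u that by simp
    show "q \<omega> \<eta> \<in> X" if "\<omega> \<subseteq> {..<m}" for \<omega> using qX that \<eta> by blast
    fix \<omega> :: "nat set" assume \<omega>: "\<omega> \<subseteq> {..<m}"
    have fin: "finite \<omega>" using \<omega> finite_subset by blast
    have "q \<omega> \<eta> = cube_vertex V x u \<omega> \<oplus> (\<Oplus>i\<in>{..<m}. \<Oplus>j\<in>\<eta>. if i \<in> \<omega> then a1 i j else a0 i j)"
      unfolding q_def by (rule cube_vertex_interpolate) (use a \<eta> in auto)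
    also have "(\<Oplus>i\<in>{..<m}. \<Oplus>j\<in>\<eta>. if i \<in> \<omega> then a1 i j else a0 i j)
        = (\<Oplus>i\<in>{..<m}. if i \<in> \<omega> then A1 i else A0 i)"
      by (rule finsum_cong') (use A in \<open>auto simp: A0_def A1_def\<close>)
    also have "cube_vertex V x u \<omega> = x \<oplus> (\<Oplus>i\<in>{..<m}. if i \<in> \<omega> then u i else \<zero>)"
      unfolding cube_vertex_def
      by (subst add.finprod_mono_neutral_cong_right [of "{..<m}" \<omega>]) (use u \<omega> in auto)
    also have "\<dots> \<oplus> (\<Oplus>i\<in>{..<m}. if i \<in> \<omega> then A1 i else A0 i)
        = x \<oplus> ((\<Oplus>i\<in>{..<m}. if i \<in> \<omega> then u i else \<zero>) \<oplus> (\<Oplus>i\<in>{..<m}. if i \<in> \<omega> then A1 i else A0 i))"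
      by (rule a_assoc [OF x]) (rule finsum_closed, use A u in auto)+
    also have "(\<Oplus>i\<in>{..<m}. if i \<in> \<omega> then u i else \<zero>) \<oplus> (\<Oplus>i\<in>{..<m}. if i \<in> \<omega> then A1 i else A0 i)
        = (\<Oplus>i\<in>{..<m}. (if i \<in> \<omega> then u i else \<zero>) \<oplus> (if i \<in> \<omega> then A1 i else A0 i))"
      by (rule finsum_addf [symmetric]) (use A u in auto)
    also have "\<dots> = (\<Oplus>i\<in>{..<m}. if i \<in> \<omega> then u i \<oplus> A1 i else A0 i)"
      by (rule finsum_cong') (use A u in auto)
    finally show "q \<omega> \<eta> = x \<oplus> (\<Oplus>i\<in>{..<m}. if i \<in> \<omega> then u i \<oplus> A1 i else A0 i)" .
  qed
  have "(\<Oplus>\<^bsub>H\<^esub>\<omega>\<in>?P. signed H \<omega> (corner_value (cube_vertex V x u \<omega>) (interpolate a0 a1 \<omega>)))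
      = (\<Oplus>\<^bsub>H\<^esub>\<omega>\<in>?P. \<ominus>\<^bsub>H\<^esub> (\<Oplus>\<^bsub>H\<^esub>\<eta>\<in>?P'. signed H \<eta> (signed H \<omega> (f (q \<omega> \<eta>)))))"
  proof (rule H.finsum_cong' [OF refl])
    show "(\<lambda>\<omega>. \<ominus>\<^bsub>H\<^esub> (\<Oplus>\<^bsub>H\<^esub>\<eta>\<in>?P'. signed H \<eta> (signed H \<omega> (f (q \<omega> \<eta>))))) \<in> ?P \<rightarrow> carrier H"
      by (intro Pi_I H.a_inv_closed H.finsum_closed signed_closed fq)
    fix \<omega> assume \<omega>: "\<omega> \<in> ?P"
    have "signed H \<omega> (\<Oplus>\<^bsub>H\<^esub>\<eta>\<in>?P'. signed H \<eta> (f (q \<omega> \<eta>)))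
        = (\<Oplus>\<^bsub>H\<^esub>\<eta>\<in>?P'. signed H \<omega> (signed H \<eta> (f (q \<omega> \<eta>))))"
      by (intro signed_finsum signed_closed fq [OF \<omega>])
    also have "\<dots> = (\<Oplus>\<^bsub>H\<^esub>\<eta>\<in>?P'. signed H \<eta> (signed H \<omega> (f (q \<omega> \<eta>))))"
      by (intro H.finsum_cong' [OF refl] Pi_I signed_closed fq [OF \<omega>] signed_commute)
    moreover have "(\<Oplus>\<^bsub>H\<^esub>\<eta>\<in>?P'. signed H \<eta> (f (q \<omega> \<eta>))) \<in> carrier H"
      by (intro H.finsum_closed Pi_I signed_closed fq [OF \<omega>])
    ultimately show "signed H \<omega> (corner_value (cube_vertex V x u \<omega>) (interpolate a0 a1 \<omega>))
        = \<ominus>\<^bsub>H\<^esub> (\<Oplus>\<^bsub>H\<^esub>\<eta>\<in>?P'. signed H \<eta> (signed H \<omega> (f (q \<omega> \<eta>))))"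
      unfolding corner_value_def q_def by (simp add: signed_minus)
  qed
  also have "\<dots> = \<ominus>\<^bsub>H\<^esub> (\<Oplus>\<^bsub>H\<^esub>\<omega>\<in>?P. \<Oplus>\<^bsub>H\<^esub>\<eta>\<in>?P'. signed H \<eta> (signed H \<omega> (f (q \<omega> \<eta>))))"
    by (intro H.finsum_minus Pi_I H.finsum_closed signed_closed fq)
  also have "(\<Oplus>\<^bsub>H\<^esub>\<omega>\<in>?P. \<Oplus>\<^bsub>H\<^esub>\<eta>\<in>?P'. signed H \<eta> (signed H \<omega> (f (q \<omega> \<eta>))))
      = (\<Oplus>\<^bsub>H\<^esub>\<eta>\<in>?P'. \<Oplus>\<^bsub>H\<^esub>\<omega>\<in>?P. signed H \<eta> (signed H \<omega> (f (q \<omega> \<eta>))))"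
    by (intro H.finsum_swap signed_closed fq) auto
  also have "\<dots> = \<zero>\<^bsub>H\<^esub>"
  proof (rule H.add.finprod_one_eqI)
    fix \<eta> assume \<eta>: "\<eta> \<in> ?P'"
    have "(\<Oplus>\<^bsub>H\<^esub>\<omega>\<in>?P. signed H \<eta> (signed H \<omega> (f (q \<omega> \<eta>))))
        = signed H \<eta> (\<Oplus>\<^bsub>H\<^esub>\<omega>\<in>?P. signed H \<omega> (f (q \<omega> \<eta>)))"
      by (intro signed_finsum [symmetric] signed_closed fq [OF _ \<eta>])
    also have "\<dots> = \<zero>\<^bsub>H\<^esub>" unfolding zero [OF \<eta>] by (simp add: signed_def)
    finally show "(\<Oplus>\<^bsub>H\<^esub>\<omega>\<in>?P. signed H \<eta> (signed H \<omega> (f (q \<omega> \<eta>)))) = \<zero>\<^bsub>H\<^esub>" .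
  qed
  finally show ?thesis by simp
qed

text \<open>
  The vertices of the cube \<open>(x|v)\<close> other than \<open>x\<close> lie in \<open>X\<close>, so there the corners of the family
  reproduce \<open>f\<close>.  The identity for alternating sums then determines the value of the corner at the
  remaining vertex \<open>x\<close> by the same formula that defines the value of \<open>v\<close>.
\<close>

lemma corner_value_interpolate:
  assumes x: "x \<in> carrier V" and v: "corner x v" and family: "corner_family x v a0 a1"
  shows "corner_value x v = corner_value x (interpolate a0 a1 {})"
proof -
  let ?g = "\<lambda>\<omega>. signed H \<omega> (corner_value (cube_vertex V x v \<omega>) (interpolate a0 a1 \<omega>))"
  have v0: "cube_vertex V x v {} = x" using x by (simp add: cube_vertex_def)
  note corner = corner_family_corner [OF family]
  have c0: "corner_value x (interpolate a0 a1 {}) \<in> carrier H"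
    using corner_value_closed [OF corner [of "{}"]] by (simp add: v0)
  have "\<zero>\<^bsub>H\<^esub> = finsum H ?g (Pow {..<m})"
    by (rule corner_values_alternating_sum [symmetric])
      (use x v family in \<open>auto simp: corner_def [of x]\<close>)
  also have "\<dots> = ?g {} \<oplus>\<^bsub>H\<^esub> finsum H ?g (Pow {..<m} - {{}})"
    by (intro finsum_Pow_split signed_closed corner_value_closed corner)
  also have "?g {} = corner_value x (interpolate a0 a1 {})"
    by (simp add: v0 signed_def)
  also have "finsum H ?g (Pow {..<m} - {{}})
      = (\<Oplus>\<^bsub>H\<^esub>\<omega>\<in>Pow {..<m} - {{}}. signed H \<omega> (f (cube_vertex V x v \<omega>)))"
    by (rule H.finsum_cong' [OF refl])
      (use v corner in \<open>auto simp: corner_value_eq corner_def [of x] intro!: signed_closed f\<close>)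
  finally have "corner_value x (interpolate a0 a1 {}) = corner_value x v"
    unfolding corner_value_def [of x v]
    by (intro H.minus_equality [symmetric]) (use c0 corner_sum_closed [OF v] in auto)
  then show ?thesis ..
qed

end

section \<open>The extension\<close>

context cube_functions
begin

text \<open>
  The letters 1 and 2 stand for a step along \<open>v\<close> and along \<open>v'\<close>, the letter 0 for no step.  Both
  families use the same vectors for the letter 0, hence they agree at the vertex \<open>x\<close>.
\<close>

lemma two_cubes_with_common_corner:
  assumes m: "m \<ge> 1" and x: "x \<in> carrier V"
    and v: "\<And>i. i < m \<Longrightarrow> v i \<in> carrier V" and v': "\<And>i. i < m \<Longrightarrow> v' i \<in> carrier V"
    and C: "\<delta> \<le> 1 - 1 / real (card (configuration_index m)) \<longrightarrow>
      real (card (configuration_index m)) * \<delta> ^ C \<le> \<delta> ^ card (configuration_index m)"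
    and \<delta>: "0 < \<delta>" and dens: "\<delta> < density V X" and unif: "uniform_subset V (\<delta> ^ C) m X"
  obtains a0 a1 a2 where "corner_family x v a0 a1" "corner_family x v' a0 a2"
proof -
  define c where "c i \<tau> = (if \<tau> = (1::nat) then v i else if \<tau> = 2 then v' i else \<zero>)" for i \<tau>
  define y where "y \<omega> = x \<oplus> (\<Oplus>i\<in>{..<m}. c i (\<omega> i))" for \<omega>
  have c: "c i \<tau> \<in> carrier V" if "i < m" for i \<tau> using v v' that by (simp add: c_def)
  have yV: "y \<omega> \<in> carrier V" for \<omega>
    unfolding y_def by (intro a_closed x finsum_closed Pi_I c) simp
  obtain r :: "nat \<Rightarrow> nat \<Rightarrow> nat \<Rightarrow> 'v" where
    r: "\<And>i \<tau> j. i < m \<Longrightarrow> \<tau> < 3 \<Longrightarrow> j < m \<Longrightarrow> r i \<tau> j \<in> carrier V"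
    and rX: "\<And>\<omega> \<eta>. \<omega> \<in> {..<m} \<rightarrow>\<^sub>E {..<3} \<Longrightarrow> \<eta> \<subseteq> {..<m} \<Longrightarrow> \<eta> \<noteq> {} \<Longrightarrow>
      y \<omega> \<oplus> (\<Oplus>i\<in>{..<m}. \<Oplus>j\<in>\<eta>. r i (\<omega> i) j) \<in> X"
    by (rule configuration_exists [OF m yV C \<delta> dens unif]) (rule that)
  have key: "corner (cube_vertex V x w \<omega>) (interpolate (\<lambda>i. r i 0) (\<lambda>i. r i \<tau>) \<omega>)"
    if \<tau>: "\<tau> < 3" "\<tau> \<noteq> 0" and w: "\<And>i. i < m \<Longrightarrow> w i = c i \<tau>" and \<omega>: "\<omega> \<subseteq> {..<m}" for w \<tau> \<omega>
    unfolding corner_def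
  proof (intro conjI allI impI)
    have r0: "r i 0 j \<in> carrier V" "r i \<tau> j \<in> carrier V" if "i < m" "j < m" for i j
      using r that \<tau> by auto
    show "interpolate (\<lambda>i. r i 0) (\<lambda>i. r i \<tau>) \<omega> j \<in> carrier V" if "j < m" for j
      unfolding interpolate_def by (intro finsum_closed) (use r0 that in auto)
    fix \<eta> :: "nat set" assume \<eta>: "\<eta> \<subseteq> {..<m}" "\<eta> \<noteq> {}"
    define \<omega>' where "\<omega>' = (\<lambda>i\<in>{..<m}. if i \<in> \<omega> then \<tau> else 0)"
    have \<omega>': "\<omega>' \<in> {..<m} \<rightarrow>\<^sub>E {..<3}"
      unfolding \<omega>'_def restrict_PiE_iff using \<tau> by auto
    have "(\<Oplus>i\<in>{..<m}. c i (\<omega>' i)) = finsum V w \<omega>"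
      by (rule add.finprod_mono_neutral_cong_right)
        (use w \<omega> c in \<open>auto simp: \<omega>'_def c_def\<close>)
    then have "y \<omega>' = cube_vertex V x w \<omega>"
      by (simp add: y_def cube_vertex_def)
    moreover have "(\<Oplus>i\<in>{..<m}. \<Oplus>j\<in>\<eta>. r i (\<omega>' i) j)
        = (\<Oplus>i\<in>{..<m}. \<Oplus>j\<in>\<eta>. if i \<in> \<omega> then r i \<tau> j else r i 0 j)"
    proof -
      have "(if i \<in> \<omega> then r i \<tau> j else r i 0 j) \<in> carrier V" if "i \<in> {..<m}" "j \<in> \<eta>" for i j
        using r0 that \<eta>(1) by auto
      then show ?thesis
        by (intro finsum_cong' [OF refl] Pi_I finsum_closed) (simp_all add: \<omega>'_def)
    qed
    ultimately show "cube_vertex V (cube_vertex V x w \<omega>) (interpolate (\<lambda>i. r i 0) (\<lambda>i. r i \<tau>) \<omega>) \<eta> \<in> X"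
      using rX [OF \<omega>' \<eta>] cube_vertex_interpolate [OF r0 \<eta>(1)] by simp
  qed
  have "corner_family x v (\<lambda>i. r i 0) (\<lambda>i. r i 1)"
    unfolding corner_family_def
    by (intro conjI allI impI key; use r in \<open>simp add: c_def\<close>)
  moreover have "corner_family x v' (\<lambda>i. r i 0) (\<lambda>i. r i 2)"
    unfolding corner_family_def
    by (intro conjI allI impI key; use r in \<open>simp add: c_def\<close>)
  ultimately show ?thesis by (rule that)
qed

text \<open>
  The common corner of two families that start from different corners at \<open>x\<close> shows that both have
  the same value, so the choice of a corner in the definition of \<open>h\<close> does not matter.  To sum \<open>h\<close>
  over a cube, the corners may therefore be chosen from an affine family.
\<close>

lemma extension_exists:
  assumes m: "m \<ge> 1"
    and C: "\<delta> \<le> 1 - 1 / real (card (configuration_index m)) \<longrightarrow>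
      real (card (configuration_index m)) * \<delta> ^ C \<le> \<delta> ^ card (configuration_index m)"
    and \<delta>: "0 < \<delta>" and dens: "\<delta> < density V X" and unif: "uniform_subset V (\<delta> ^ C) m X"
  shows "\<exists>h\<in>carrier V \<rightarrow> carrier H.
    (\<forall>c\<in>cubes V m (carrier V). cube_sum V H m h c = \<zero>\<^bsub>H\<^esub>) \<and> (\<forall>x\<in>X. h x = f x)"
proof -
  note config = two_cubes_with_common_corner [OF m _ _ _ C \<delta> dens unif]
  have ex: "\<exists>p. corner x p" if x: "x \<in> carrier V" for x
  proof -
    obtain a0 a1 a2 where "corner_family x (\<lambda>_. \<zero>) a0 a1" "corner_family x (\<lambda>_. \<zero>) a0 a2"
      by (rule config [OF x zero_closed zero_closed])
    from corner_family_corner [OF this(1), of "{}"] have "corner x (interpolate a0 a1 {})"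
      using x by (simp add: cube_vertex_def)
    then show ?thesis by blast
  qed
  have unique: "corner_value x v = corner_value x v'"
    if x: "x \<in> carrier V" and v: "corner x v" "corner x v'" for x v v'
  proof -
    have vV: "v i \<in> carrier V" "v' i \<in> carrier V" if "i < m" for i
      using v that by (simp_all add: corner_def)
    obtain a0 a1 a2 where family: "corner_family x v a0 a1" "corner_family x v' a0 a2"
      by (rule config [OF x vV])
    have "corner_value x v = corner_value x (interpolate a0 a1 {})"
      by (rule corner_value_interpolate [OF x v(1) family(1)])
    moreover have "corner_value x v' = corner_value x (interpolate a0 a2 {})"
      by (rule corner_value_interpolate [OF x v(2) family(2)])
    moreover have "interpolate a0 a1 {} = interpolate a0 a2 {}"
      by (simp add: interpolate_def fun_eq_iff)
    ultimately show ?thesis by simp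
  qed
  define h where "h x = corner_value x (SOME p. corner x p)" for x
  have h: "h x = corner_value x p" if "x \<in> carrier V" "corner x p" for x p
    unfolding h_def by (rule unique [OF that(1) someI [where P = "corner x", OF that(2)] that(2)])
  have "h x \<in> carrier H" if x: "x \<in> carrier V" for x
  proof -
    obtain p where "corner x p" using ex [OF x] by blast
    then show ?thesis using h [OF x] corner_value_closed by simp
  qed
  moreover have "h x = f x" if x: "x \<in> X" for x
  proof -
    have xV: "x \<in> carrier V" using x X by blast
    obtain p where "corner x p" using ex [OF xV] by blast
    then show ?thesis using h [OF xV] corner_value_eq [OF x] by simp
  qed
  moreover have "cube_sum V H m h (x, u) = \<zero>\<^bsub>H\<^esub>" if xu: "(x, u) \<in> cubes V m (carrier V)" for x u
  proof -
    have x: "x \<in> carrier V" and vert: "\<And>\<omega>. \<omega> \<subseteq> {..<m} \<Longrightarrow> cube_vertex V x u \<omega> \<in> carrier V"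
      and "u \<in> {..<m} \<rightarrow>\<^sub>E carrier V"
      using xu by (simp_all add: cubes_def)
    then have u: "u i \<in> carrier V" if "i < m" for i using PiE_mem that by blast
    obtain a0 a1 a2 where family: "corner_family x u a0 a1" "corner_family x (\<lambda>_. \<zero>) a0 a2"
      by (rule config [OF x u zero_closed])
    note corner = corner_family_corner [OF family(1)]
    have "cube_sum V H m h (x, u) = (\<Oplus>\<^bsub>H\<^esub>\<omega>\<in>Pow {..<m}.
        signed H \<omega> (corner_value (cube_vertex V x u \<omega>) (interpolate a0 a1 \<omega>)))"
      unfolding cube_sum_signed
    proof (rule H.finsum_cong' [OF refl])
      show "(\<lambda>\<omega>. signed H \<omega> (corner_value (cube_vertex V x u \<omega>) (interpolate a0 a1 \<omega>)))
          \<in> Pow {..<m} \<rightarrow> carrier H"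
        by (intro Pi_I signed_closed corner_value_closed corner) simp
      show "signed H \<omega> (h (cube_vertex V x u \<omega>))
          = signed H \<omega> (corner_value (cube_vertex V x u \<omega>) (interpolate a0 a1 \<omega>))"
        if "\<omega> \<in> Pow {..<m}" for \<omega>
        using h [OF vert corner] that by simp
    qed
    also have "\<dots> = \<zero>\<^bsub>H\<^esub>"
      by (rule corner_values_alternating_sum [OF x u family(1)])
    finally show ?thesis .
  qed
  ultimately show ?thesis by (intro bexI [of _ h]) auto
qed

end

text \<open>
  Linear combinations of a finite spanning set with coefficients in a finite field are finite in
  number.
\<close>

lemma finite_abelian_group_if_fin_dim:
  fixes K :: "'k ring" and V :: "('k, 'v) module"
  assumes "finite (carrier K)" "fin_dim_vector_space K V"
  shows "finite_abelian_group V"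
proof -
  interpret module K V using assms(2) by (simp add: fin_dim_vector_space_def)
  obtain B where B: "finite B" "B \<subseteq> carrier V"
    "\<forall>x\<in>carrier V. \<exists>a\<in>B \<rightarrow> carrier K. x = (\<Oplus>\<^bsub>V\<^esub>b\<in>B. a b \<odot>\<^bsub>V\<^esub> b)"
    using assms(2) unfolding fin_dim_vector_space_def by blast
  have "carrier V \<subseteq> (\<lambda>a. \<Oplus>\<^bsub>V\<^esub>b\<in>B. a b \<odot>\<^bsub>V\<^esub> b) ` (B \<rightarrow>\<^sub>E carrier K)"
  proof
    fix x assume "x \<in> carrier V"
    then obtain a where a: "a \<in> B \<rightarrow> carrier K" "x = (\<Oplus>\<^bsub>V\<^esub>b\<in>B. a b \<odot>\<^bsub>V\<^esub> b)" using B(3) by blast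
    have aK: "a b \<in> carrier K" if "b \<in> B" for b using a(1) that by blast
    have "x = (\<Oplus>\<^bsub>V\<^esub>b\<in>B. restrict a B b \<odot>\<^bsub>V\<^esub> b)"
      unfolding a(2) by (rule M.finsum_cong') (use aK B(2) in auto)
    moreover have "restrict a B \<in> B \<rightarrow>\<^sub>E carrier K"
      unfolding restrict_PiE_iff using aK by blast
    ultimately show "x \<in> (\<lambda>a. \<Oplus>\<^bsub>V\<^esub>b\<in>B. a b \<odot>\<^bsub>V\<^esub> b) ` (B \<rightarrow>\<^sub>E carrier K)" by (rule image_eqI)
  qed
  then have "finite (carrier V)"
    by (rule finite_subset) (simp add: finite_PiE B(1) assms(1))
  then show ?thesis by unfold_locales
qed

lemma extension_property_power:
  assumes m: "m \<ge> 1"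
    and C: "\<delta> \<le> 1 - 1 / real (card (configuration_index m)) \<longrightarrow>
      real (card (configuration_index m)) * \<delta> ^ C \<le> \<delta> ^ card (configuration_index m)"
    and \<delta>: "0 < \<delta>"
  shows "extension_property TYPE('k) TYPE('v) TYPE('h) m \<delta> (\<delta> ^ C)"
  unfolding extension_property_def
proof (intro allI impI)
  fix K :: "'k ring" and V :: "('k, 'v) module" and H :: "'h ring" and X f
  assume K: "finite (carrier K)" "fin_dim_vector_space K V" and H: "abelian_group H"
    and unif: "uniform_subset V (\<delta> ^ C) m X" and dens: "\<delta> < density V X"
    and f: "f \<in> X \<rightarrow> carrier H" "\<forall>c\<in>cubes V m X. cube_sum V H m f c = \<zero>\<^bsub>H\<^esub>"
  interpret V: finite_abelian_group V
    by (rule finite_abelian_group_if_fin_dim [OF K])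
  interpret H: abelian_group H by (rule H)
  interpret cube_functions V H m X f
    by unfold_locales (use unif f in \<open>auto simp: uniform_subset_def\<close>)
  show "\<exists>h\<in>carrier V \<rightarrow> carrier H.
      (\<forall>c\<in>cubes V m (carrier V). cube_sum V H m h c = \<zero>\<^bsub>H\<^esub>) \<and> (\<forall>x\<in>X. h x = f x)"
    by (rule extension_exists [OF m C \<delta> dens unif])
qed

section \<open>Transfer to structures on the natural numbers\<close>

locale additive_hom = G: abelian_group G + G': abelian_group G'
  for G :: "('a, 'c) ring_scheme" and G' :: "('b, 'd) ring_scheme" and h +
  assumes hom_closed: "x \<in> carrier G \<Longrightarrow> h x \<in> carrier G'"
    and hom_add: "x \<in> carrier G \<Longrightarrow> y \<in> carrier G \<Longrightarrow> h (x \<oplus>\<^bsub>G\<^esub> y) = h x \<oplus>\<^bsub>G'\<^esub> h y"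
begin

lemma hom_zero: "h \<zero>\<^bsub>G\<^esub> = \<zero>\<^bsub>G'\<^esub>"
proof -
  have "h \<zero>\<^bsub>G\<^esub> \<oplus>\<^bsub>G'\<^esub> h \<zero>\<^bsub>G\<^esub> = h \<zero>\<^bsub>G\<^esub>"
    using hom_add [of "\<zero>\<^bsub>G\<^esub>" "\<zero>\<^bsub>G\<^esub>"] by simp
  then show ?thesis using hom_closed by (simp add: G'.add.l_cancel_one)
qed

lemma hom_minus: "x \<in> carrier G \<Longrightarrow> h (\<ominus>\<^bsub>G\<^esub> x) = \<ominus>\<^bsub>G'\<^esub> h x"
  using hom_add [of "\<ominus>\<^bsub>G\<^esub> x" x] hom_closed
  by (intro G'.minus_equality [symmetric]) (simp_all add: hom_zero G.l_neg)

lemma hom_finsum: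
  assumes "\<And>a. a \<in> A \<Longrightarrow> g a \<in> carrier G"
  shows "h (finsum G g A) = (\<Oplus>\<^bsub>G'\<^esub>a\<in>A. h (g a))"
  using assms
proof (induction A rule: infinite_finite_induct)
  case (insert a A)
  then have "g \<in> A \<rightarrow> carrier G" "(\<lambda>a. h (g a)) \<in> A \<rightarrow> carrier G'"
    using hom_closed by auto
  then show ?case
    using insert hom_closed by (simp add: hom_add)
qed (simp_all add: hom_zero)

end

text \<open>
  The subgroup \<open>L\<close> is copied along \<open>\<phi>\<close> to the carrier of \<open>G'\<close>.  For \<open>V\<close> it is the whole group, for \<open>H\<close>
  a countable subgroup, which is then embedded into \<open>H\<close> by the inverse of \<open>\<phi>\<close>.
\<close>

lemma transported_abelian_group:
  fixes G :: "('a, 'c) ring_scheme" and G' :: "('b, 'd) ring_scheme"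
  assumes G: "abelian_group G" and L: "L \<subseteq> carrier G" "\<zero>\<^bsub>G\<^esub> \<in> L"
    "\<And>x y. x \<in> L \<Longrightarrow> y \<in> L \<Longrightarrow> x \<oplus>\<^bsub>G\<^esub> y \<in> L" "\<And>x. x \<in> L \<Longrightarrow> \<ominus>\<^bsub>G\<^esub> x \<in> L"
    and inj: "inj_on \<phi> L"
    and G': "carrier G' = \<phi> ` L" "\<zero>\<^bsub>G'\<^esub> = \<phi> \<zero>\<^bsub>G\<^esub>"
    and add: "\<And>x y. x \<in> L \<Longrightarrow> y \<in> L \<Longrightarrow> \<phi> x \<oplus>\<^bsub>G'\<^esub> \<phi> y = \<phi> (x \<oplus>\<^bsub>G\<^esub> y)"
  shows "additive_hom G' G (inv_into L \<phi>)"
proof -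
  interpret G: abelian_group G by (rule G)
  have LG: "x \<in> carrier G" if "x \<in> L" for x using L(1) that by blast
  interpret G': abelian_group G'
  proof (rule abelian_groupI)
    show "\<exists>y\<in>carrier G'. y \<oplus>\<^bsub>G'\<^esub> x = \<zero>\<^bsub>G'\<^esub>" if x: "x \<in> carrier G'" for x
    proof -
      obtain a where a: "a \<in> L" "x = \<phi> a" using x by (auto simp: G')
      have "\<phi> (\<ominus>\<^bsub>G\<^esub> a) \<oplus>\<^bsub>G'\<^esub> x = \<zero>\<^bsub>G'\<^esub>"
        using a L(4) LG by (simp add: add G' G.l_neg)
      then show ?thesis using a L(4) by (auto simp: G')
    qed
  qed (use L(2,3) LG in \<open>auto simp: G' add G.a_ac\<close>)
  show ?thesis
    by unfold_locales (use inj L(3) LG in \<open>auto simp: G' add\<close>)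
qed

lemma cube_vertex_hom:
  fixes V :: "('k, 'v) module" and V' :: "('l, 'w) module"
  assumes "additive_hom V V' \<psi>" "u \<in> carrier V" "\<And>i. i \<in> \<omega> \<Longrightarrow> v i \<in> carrier V"
    and "\<And>i. i \<in> \<omega> \<Longrightarrow> v' i = \<psi> (v i)"
  shows "cube_vertex V' (\<psi> u) v' \<omega> = \<psi> (cube_vertex V u v \<omega>)"
proof -
  interpret additive_hom V V' \<psi> by (rule assms(1))
  have "finsum V' v' \<omega> = (\<Oplus>\<^bsub>V'\<^esub>i\<in>\<omega>. \<psi> (v i))"
    by (rule G'.finsum_cong') (use assms hom_closed in auto)
  then show ?thesis
    using assms by (simp add: cube_vertex_def hom_add hom_finsum Pi_iff)
qed

lemma cube_sum_hom:
  assumes V: "additive_hom V V' \<psi>" and H: "additive_hom H H' \<iota>"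
    and u: "u \<in> carrier V" and v: "\<And>i. i < m \<Longrightarrow> v i \<in> carrier V" "\<And>i. i < m \<Longrightarrow> v' i = \<psi> (v i)"
    and g: "\<And>\<omega>. \<omega> \<subseteq> {..<m} \<Longrightarrow> g (cube_vertex V u v \<omega>) \<in> carrier H"
      "\<And>\<omega>. \<omega> \<subseteq> {..<m} \<Longrightarrow> g' (\<psi> (cube_vertex V u v \<omega>)) = \<iota> (g (cube_vertex V u v \<omega>))"
  shows "cube_sum V' H' m g' (\<psi> u, v') = \<iota> (cube_sum V H m g (u, v))"
proof -
  interpret H: additive_hom H H' \<iota> by (rule H)
  have vertex: "cube_vertex V' (\<psi> u) v' \<omega> = \<psi> (cube_vertex V u v \<omega>)" if "\<omega> \<subseteq> {..<m}" for \<omega>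
    by (rule cube_vertex_hom [OF V u]) (use v that in auto)
  let ?s = "\<lambda>\<omega>. if even (card \<omega>) then g (cube_vertex V u v \<omega>) else \<ominus>\<^bsub>H\<^esub> g (cube_vertex V u v \<omega>)"
  have s: "?s \<omega> \<in> carrier H" if "\<omega> \<subseteq> {..<m}" for \<omega> using g(1) [OF that] by simp
  have "\<iota> (finsum H ?s (Pow {..<m})) = (\<Oplus>\<^bsub>H'\<^esub>\<omega>\<in>Pow {..<m}. \<iota> (?s \<omega>))"
    by (rule H.hom_finsum) (use s in blast)
  also have "\<dots> = cube_sum V' H' m g' (\<psi> u, v')"
    unfolding cube_sum_def prod.case
  proof (rule H.G'.finsum_cong' [OF refl, symmetric])
    show "(\<lambda>\<omega>. \<iota> (?s \<omega>)) \<in> Pow {..<m} \<rightarrow> carrier H'"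
      by (intro Pi_I H.hom_closed s) simp
  qed (use g vertex in \<open>auto simp: H.hom_minus\<close>)
  finally show ?thesis by (simp add: cube_sum_def)
qed

lemma gowers_norm_iso:
  fixes V :: "('k, 'v) module" and V' :: "('l, 'w) module"
  assumes V: "additive_hom V V' \<psi>" and bij: "bij_betw \<psi> (carrier V) (carrier V')"
    and g: "\<And>x. x \<in> carrier V \<Longrightarrow> g' (\<psi> x) = g x"
  shows "gowers_norm V' m g' = gowers_norm V m g"
proof -
  interpret additive_hom V V' \<psi> by (rule V)
  let ?D = "\<lambda>A. A \<times> ({..<m} \<rightarrow>\<^sub>E A)"
  let ?T = "\<lambda>(x, v). (\<psi> x, \<lambda>i\<in>{..<m}. \<psi> (v i))"
  let ?inv = "inv_into (carrier V) \<psi>"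
  have inv: "?inv (\<psi> x) = x" if "x \<in> carrier V" for x
    using bij that by (simp add: bij_betw_inv_into_left)
  have inv': "\<psi> (?inv y) = y" "?inv y \<in> carrier V" if "y \<in> carrier V'" for y
    using bij that by (simp_all add: bij_betw_inv_into_right bij_betw_def inv_into_into)
  have T: "bij_betw ?T (?D (carrier V)) (?D (carrier V'))"
  proof (rule bij_betw_byWitness [where f' = "\<lambda>(x, v). (?inv x, \<lambda>i\<in>{..<m}. ?inv (v i))"])
    show "\<forall>p\<in>?D (carrier V). (\<lambda>(x, v). (?inv x, \<lambda>i\<in>{..<m}. ?inv (v i))) (?T p) = p"
      using inv by (auto simp: fun_eq_iff PiE_iff extensional_def)
    show "\<forall>p\<in>?D (carrier V'). ?T ((\<lambda>(x, v). (?inv x, \<lambda>i\<in>{..<m}. ?inv (v i))) p) = p"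
      using inv' by (auto simp: fun_eq_iff PiE_iff extensional_def)
    show "?T ` ?D (carrier V) \<subseteq> ?D (carrier V')"
      using hom_closed by (auto simp: PiE_iff)
    show "(\<lambda>(x, v). (?inv x, \<lambda>i\<in>{..<m}. ?inv (v i))) ` ?D (carrier V') \<subseteq> ?D (carrier V)"
      using inv' by (auto simp: PiE_iff)
  qed
  let ?F = "\<lambda>V g (x, v). \<Prod>\<omega>\<in>Pow {..<m}. if even (card \<omega>) then g (cube_vertex V x v \<omega>)
      else cnj (g (cube_vertex V x v \<omega>))"
  have F: "?F V' g' (?T p) = ?F V g p" if "p \<in> ?D (carrier V)" for p
  proof -
    obtain x v where p: "p = (x, v)" "x \<in> carrier V" "\<And>i. i < m \<Longrightarrow> v i \<in> carrier V"
      using \<open>p \<in> ?D (carrier V)\<close> by (auto simp: PiE_iff)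
    have "g' (cube_vertex V' (\<psi> x) (\<lambda>i\<in>{..<m}. \<psi> (v i)) \<omega>) = g (cube_vertex V x v \<omega>)"
      if \<omega>: "\<omega> \<in> Pow {..<m}" for \<omega>
    proof -
      have "cube_vertex V' (\<psi> x) (\<lambda>i\<in>{..<m}. \<psi> (v i)) \<omega> = \<psi> (cube_vertex V x v \<omega>)"
        by (rule cube_vertex_hom [OF V]) (use p \<omega> in auto)
      moreover have "cube_vertex V x v \<omega> \<in> carrier V"
        unfolding cube_vertex_def by (intro G.a_closed G.finsum_closed) (use p \<omega> in auto)
      ultimately show ?thesis using g by simp
    qed
    then show ?thesis unfolding p(1) prod.case by (intro prod.cong refl) simp
  qed
  have "(\<Sum>q\<in>?D (carrier V'). ?F V' g' q) = (\<Sum>p\<in>?D (carrier V). ?F V' g' (?T p))"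
    by (rule sum.reindex_bij_betw [OF T, symmetric])
  also have "\<dots> = (\<Sum>p\<in>?D (carrier V). ?F V g p)"
    by (rule sum.cong [OF refl F])
  finally show ?thesis
    using bij_betw_same_card [OF T] by (simp add: gowers_norm_def average_def)
qed

lemma uniform_subset_iso:
  fixes V :: "('k, 'v) module" and V' :: "('l, 'w) module"
  assumes V: "additive_hom V V' \<psi>" and bij: "bij_betw \<psi> (carrier V) (carrier V')"
    and X: "X \<subseteq> carrier V"
  shows "density V X = density V' (\<psi> ` X)"
    and "uniform_subset V \<epsilon> m X \<longleftrightarrow> uniform_subset V' \<epsilon> m (\<psi> ` X)"
proof -
  have inj: "inj_on \<psi> (carrier V)" using bij by (rule bij_betw_imp_inj_on)
  show dens: "density V X = density V' (\<psi> ` X)"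
    using card_image [OF inj_on_subset [OF inj X]] bij_betw_same_card [OF bij]
    by (simp add: density_def)
  have "gowers_norm V' m (\<lambda>x. indicator (\<psi> ` X) x - complex_of_real (density V X))
      = gowers_norm V m (\<lambda>x. indicator X x - complex_of_real (density V X))"
    by (rule gowers_norm_iso [OF V bij])
      (use X in \<open>auto simp: indicator_def inj_on_image_mem_iff [OF inj]\<close>)
  moreover have "\<psi> ` X \<subseteq> carrier V'" using bij X by (auto simp: bij_betw_def)
  ultimately show "uniform_subset V \<epsilon> m X \<longleftrightarrow> uniform_subset V' \<epsilon> m (\<psi> ` X)"
    using X by (simp add: uniform_subset_def dens)
qed

text \<open>
  The maps \<open>\<psi>\<close> and \<open>\<iota>\<close> take cubes and alternating sums to their images.  Injectivity of \<open>\<iota>\<close> carries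
  the hypothesis on \<open>f'\<close> back to \<open>f\<close>, and the inverse of \<open>\<psi>\<close> carries the extension \<open>h\<close> forward.
\<close>

lemma extension_transfer:
  fixes V :: "('k, 'v) module" and V' :: "('l, 'w) module"
  assumes V: "additive_hom V V' \<psi>" and bij: "bij_betw \<psi> (carrier V) (carrier V')"
    and H: "additive_hom H H' \<iota>" and inj: "inj_on \<iota> (carrier H)"
    and X: "X \<subseteq> carrier V" and f: "\<And>x. x \<in> X \<Longrightarrow> f x \<in> carrier H"
      "\<And>x. x \<in> X \<Longrightarrow> f' (\<psi> x) = \<iota> (f x)"
    and f'0: "\<forall>c\<in>cubes V' m (\<psi> ` X). cube_sum V' H' m f' c = \<zero>\<^bsub>H'\<^esub>"
    and ext: "(\<forall>c\<in>cubes V m X. cube_sum V H m f c = \<zero>\<^bsub>H\<^esub>) \<Longrightarrow>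
      \<exists>h\<in>carrier V \<rightarrow> carrier H.
        (\<forall>c\<in>cubes V m (carrier V). cube_sum V H m h c = \<zero>\<^bsub>H\<^esub>) \<and> (\<forall>x\<in>X. h x = f x)"
  shows "\<exists>h\<in>carrier V' \<rightarrow> carrier H'.
    (\<forall>c\<in>cubes V' m (carrier V'). cube_sum V' H' m h c = \<zero>\<^bsub>H'\<^esub>) \<and> (\<forall>x\<in>\<psi> ` X. h x = f' x)"
proof -
  interpret V: additive_hom V V' \<psi> by (rule V)
  interpret H: additive_hom H H' \<iota> by (rule H)
  let ?inv = "inv_into (carrier V) \<psi>"
  have inv: "?inv (\<psi> x) = x" if "x \<in> carrier V" for x
    using bij that by (simp add: bij_betw_inv_into_left)
  have inv': "\<psi> (?inv y) = y" "?inv y \<in> carrier V" if "y \<in> carrier V'" for y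
    using bij that by (simp_all add: bij_betw_inv_into_right bij_betw_def inv_into_into)
  have "cube_sum V H m f (u, v) = \<zero>\<^bsub>H\<^esub>" if uv: "(u, v) \<in> cubes V m X" for u v
  proof -
    have u: "u \<in> carrier V" and vert: "\<And>\<omega>. \<omega> \<subseteq> {..<m} \<Longrightarrow> cube_vertex V u v \<omega> \<in> X"
      and vE: "v \<in> {..<m} \<rightarrow>\<^sub>E carrier V"
      using uv by (simp_all add: cubes_def)
    have v: "v i \<in> carrier V" if "i < m" for i
      by (rule PiE_mem [OF vE]) (simp add: that)
    define v' where "v' = (\<lambda>i\<in>{..<m}. \<psi> (v i))"
    have v': "v' i = \<psi> (v i)" if "i < m" for i using that by (simp add: v'_def)
    have "v' \<in> {..<m} \<rightarrow>\<^sub>E carrier V'"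
      unfolding v'_def restrict_PiE_iff using v V.hom_closed by simp
    moreover have "cube_vertex V' (\<psi> u) v' \<omega> \<in> \<psi> ` X" if \<omega>: "\<omega> \<subseteq> {..<m}" for \<omega>
    proof -
      have "cube_vertex V' (\<psi> u) v' \<omega> = \<psi> (cube_vertex V u v \<omega>)"
        by (rule cube_vertex_hom [OF V u]) (use v v' \<omega> in auto)
      then show ?thesis using vert [OF \<omega>] by simp
    qed
    ultimately have "(\<psi> u, v') \<in> cubes V' m (\<psi> ` X)"
      using u V.hom_closed by (simp add: cubes_def)
    then have "\<zero>\<^bsub>H'\<^esub> = cube_sum V' H' m f' (\<psi> u, v')" using f'0 by simp
    also have "\<dots> = \<iota> (cube_sum V H m f (u, v))"
      by (rule cube_sum_hom [OF V H u v v']) (use vert f in auto)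
    finally have "\<iota> (cube_sum V H m f (u, v)) = \<iota> \<zero>\<^bsub>H\<^esub>" by (simp add: H.hom_zero)
    moreover have "cube_sum V H m f (u, v) \<in> carrier H"
      unfolding cube_sum_def prod.case by (rule H.G.finsum_closed) (use vert f in auto)
    ultimately show ?thesis using inj by (simp add: inj_on_eq_iff)
  qed
  then have "\<forall>c\<in>cubes V m X. cube_sum V H m f c = \<zero>\<^bsub>H\<^esub>"
    by auto
  from ext [OF this] obtain h where "h \<in> carrier V \<rightarrow> carrier H"
    "\<forall>c\<in>cubes V m (carrier V). cube_sum V H m h c = \<zero>\<^bsub>H\<^esub>" "\<forall>x\<in>X. h x = f x"
    by (elim bexE conjE)
  note h = funcset_mem [OF this(1)] bspec [OF this(2)] bspec [OF this(3)]
  define h' where "h' y = \<iota> (h (?inv y))" for y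
  have "h' y \<in> carrier H'" if "y \<in> carrier V'" for y
    unfolding h'_def by (intro H.hom_closed h inv' that)
  moreover have "h' (\<psi> x) = f' (\<psi> x)" if "x \<in> X" for x
    using that X h(3) f(2) by (auto simp: h'_def inv)
  moreover have "cube_sum V' H' m h' (u', v') = \<zero>\<^bsub>H'\<^esub>" if uv: "(u', v') \<in> cubes V' m (carrier V')" for u' v'
  proof -
    have u': "u' \<in> carrier V'" and vE': "v' \<in> {..<m} \<rightarrow>\<^sub>E carrier V'"
      using uv by (simp_all add: cubes_def)
    have v': "v' i \<in> carrier V'" if "i < m" for i
      by (rule PiE_mem [OF vE']) (simp add: that)
    define u where "u = ?inv u'"
    define v where "v = (\<lambda>i\<in>{..<m}. ?inv (v' i))"
    have u: "u \<in> carrier V" "u' = \<psi> u" using inv' [OF u'] by (simp_all add: u_def)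
    have v: "v i \<in> carrier V" "v' i = \<psi> (v i)" if "i < m" for i
      using inv' [OF v'] that by (simp_all add: v_def)
    have vE: "v \<in> {..<m} \<rightarrow>\<^sub>E carrier V"
      unfolding v_def restrict_PiE_iff using inv' v' by simp
    have vert: "cube_vertex V u v \<omega> \<in> carrier V" if "\<omega> \<subseteq> {..<m}" for \<omega>
      unfolding cube_vertex_def by (intro V.G.a_closed V.G.finsum_closed u) (use v that in auto)
    have "(u, v) \<in> cubes V m (carrier V)" using u(1) vE vert by (simp add: cubes_def)
    moreover have "cube_sum V' H' m h' (\<psi> u, v') = \<iota> (cube_sum V H m h (u, v))"
      by (rule cube_sum_hom [OF V H u(1) v]) (use vert h(1) inv in \<open>auto simp: h'_def\<close>)
    ultimately show ?thesis using h(2) by (simp add: u(2) H.hom_zero)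
  qed
  ultimately show ?thesis by (intro bexI [of _ h']) auto
qed

text \<open>
  Every element of the generated subgroup is the product of a finite word in the generators and
  their inverses.
\<close>

lemma countable_generate:
  assumes "group G" "A \<subseteq> carrier G" "countable A"
  shows "countable (generate G A)"
proof -
  interpret group G by (rule assms(1))
  let ?B = "A \<union> m_inv G ` A"
  let ?ev = "\<lambda>w. foldr (mult G) w \<one>\<^bsub>G\<^esub>"
  have B: "?B \<subseteq> carrier G" using assms(2) by auto
  have ev_closed: "?ev w \<in> carrier G" if "w \<in> lists ?B" for w
    using that B by (induction w) auto
  have ev_append: "?ev (w @ w') = ?ev w \<otimes>\<^bsub>G\<^esub> ?ev w'" if "w \<in> lists ?B" "w' \<in> lists ?B" for w w'
    using that(1)
  proof (induction w)
    case (Cons b w)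
    then show ?case using B ev_closed [OF Cons(2)] ev_closed [OF that(2)] by (auto simp: m_assoc)
  qed (use ev_closed that in simp)
  have words: "x \<in> ?ev ` lists ?B" if "x \<in> generate G A" for x
    using that
  proof induction
    case one
    then show ?case by (rule image_eqI [of _ _ "[]"]) simp_all
  next
    case (incl h)
    then show ?case using assms(2) by (intro image_eqI [of _ _ "[h]"]) auto
  next
    case (inv h)
    then show ?case using assms(2) by (intro image_eqI [of _ _ "[m_inv G h]"]) auto
  next
    case (eng h1 h2)
    then obtain w1 w2 where "w1 \<in> lists ?B" "h1 = ?ev w1" "w2 \<in> lists ?B" "h2 = ?ev w2" by blast
    then show ?case by (intro image_eqI [of _ _ "w1 @ w2"]) (simp_all add: ev_append del: foldr_append)
  qed
  have countable_words: "countable (?ev ` lists ?B)"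
    using assms(3) by (intro countable_image countable_lists) auto
  show ?thesis
    by (rule countable_subset [OF _ countable_words]) (rule subsetI, rule words)
qed

definition image_module ::
    "('k \<Rightarrow> 'l) \<Rightarrow> ('v \<Rightarrow> 'w) \<Rightarrow> 'k ring \<Rightarrow> ('k, 'v) module \<Rightarrow> ('l, 'w) module" where
  "image_module \<kappa> \<phi> K V = ring.extend (image_ring \<phi> V)
     \<lparr>smult = (\<lambda>a x. \<phi> (inv_into (carrier K) \<kappa> a \<odot>\<^bsub>V\<^esub> inv_into (carrier V) \<phi> x))\<rparr>"

lemma image_module_simps:
  "carrier (image_module \<kappa> \<phi> K V) = \<phi> ` carrier V"
  "\<zero>\<^bsub>image_module \<kappa> \<phi> K V\<^esub> = \<phi> \<zero>\<^bsub>V\<^esub>"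
  "x \<oplus>\<^bsub>image_module \<kappa> \<phi> K V\<^esub> y = \<phi> (inv_into (carrier V) \<phi> x \<oplus>\<^bsub>V\<^esub> inv_into (carrier V) \<phi> y)"
  "a \<odot>\<^bsub>image_module \<kappa> \<phi> K V\<^esub> x = \<phi> (inv_into (carrier K) \<kappa> a \<odot>\<^bsub>V\<^esub> inv_into (carrier V) \<phi> x)"
  by (simp_all add: image_module_def image_ring_def image_group_def ring.defs monoid.defs)

lemma image_ring_add:
  "x \<oplus>\<^bsub>image_ring \<phi> R\<^esub> y = \<phi> (inv_into (carrier R) \<phi> x \<oplus>\<^bsub>R\<^esub> inv_into (carrier R) \<phi> y)"
  by (simp add: image_ring_def image_group_def monoid.defs)

text \<open>
  The set of all vectors spans.
\<close>

lemma fin_dim_vector_space_if_finite: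
  fixes K :: "'k ring" and V :: "('k, 'v) module"
  assumes "Ring.field K" "Module.module K V" "finite (carrier V)"
  shows "fin_dim_vector_space K V"
proof -
  interpret module K V by (rule assms(2))
  have "\<exists>a\<in>carrier V \<rightarrow> carrier K. x = (\<Oplus>\<^bsub>V\<^esub>b\<in>carrier V. a b \<odot>\<^bsub>V\<^esub> b)" if x: "x \<in> carrier V" for x
  proof (rule bexI)
    let ?a = "\<lambda>b. if b = x then \<one>\<^bsub>K\<^esub> else \<zero>\<^bsub>K\<^esub>"
    have "(\<Oplus>\<^bsub>V\<^esub>b\<in>carrier V. ?a b \<odot>\<^bsub>V\<^esub> b) = (\<Oplus>\<^bsub>V\<^esub>b\<in>carrier V. if x = b then b else \<zero>\<^bsub>V\<^esub>)"
      by (rule M.finsum_cong') auto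
    also have "\<dots> = x"
      by (rule M.finsum_singleton [OF x assms(3)]) simp
    finally show "x = (\<Oplus>\<^bsub>V\<^esub>b\<in>carrier V. ?a b \<odot>\<^bsub>V\<^esub> b)" ..
  qed auto
  then show ?thesis
    unfolding fin_dim_vector_space_def using assms by blast
qed

lemma image_module_fin_dim:
  fixes K :: "'k ring" and V :: "('k, 'v) module"
  assumes K: "Ring.field K" "inj_on \<kappa> (carrier K)"
    and V: "Module.module K V" "inj_on \<phi> (carrier V)" "finite (carrier V)"
  shows "fin_dim_vector_space (image_ring \<kappa> K) (image_module \<kappa> \<phi> K V)"
    and "additive_hom (image_module \<kappa> \<phi> K V) V (inv_into (carrier V) \<phi>)"
proof -
  interpret K: field K by (rule K(1))
  interpret module K V by (rule V(1))
  let ?K = "image_ring \<kappa> K" and ?V = "image_module \<kappa> \<phi> K V"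
  show hom: "additive_hom ?V V (inv_into (carrier V) \<phi>)"
    by (rule transported_abelian_group [where L = "carrier V" and \<phi> = \<phi>])
      (use V(2) M.abelian_group_axioms in \<open>auto simp: image_module_simps\<close>)
  interpret hom: additive_hom ?V V "inv_into (carrier V) \<phi>" by (rule hom)
  have K': "Ring.field ?K" by (rule K.inj_imp_image_ring_is_field [OF K(2)])
  interpret K': field ?K by (rule K')
  have iso: "\<kappa> \<in> ring_iso K ?K" by (rule inj_imp_image_ring_iso [OF K(2)])
  have "Module.module ?K ?V"
  proof (rule moduleI)
    show "cring ?K" by (rule K'.is_cring)
    show "abelian_group ?V" by (rule hom.G.abelian_group_axioms)
    have add: "\<kappa> a \<oplus>\<^bsub>?K\<^esub> \<kappa> b = \<kappa> (a \<oplus>\<^bsub>K\<^esub> b)" and mult: "\<kappa> a \<otimes>\<^bsub>?K\<^esub> \<kappa> b = \<kappa> (a \<otimes>\<^bsub>K\<^esub> b)"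
      if "a \<in> carrier K" "b \<in> carrier K" for a b
      using iso that by (simp_all add: ring_iso_def ring_hom_def)
    have one: "\<one>\<^bsub>?K\<^esub> = \<kappa> \<one>\<^bsub>K\<^esub>" by (rule image_ring_one)
    have smult: "\<kappa> a \<odot>\<^bsub>?V\<^esub> \<phi> x = \<phi> (a \<odot>\<^bsub>V\<^esub> x)" if "a \<in> carrier K" "x \<in> carrier V" for a x
      using that K(2) V(2) by (simp add: image_module_simps)
    have vadd: "\<phi> x \<oplus>\<^bsub>?V\<^esub> \<phi> y = \<phi> (x \<oplus>\<^bsub>V\<^esub> y)" if "x \<in> carrier V" "y \<in> carrier V" for x y
      using that V(2) by (simp add: image_module_simps)
    show "\<one>\<^bsub>?K\<^esub> \<odot>\<^bsub>?V\<^esub> x = x" if "x \<in> carrier ?V" for x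
      using that by (auto simp: image_module_simps(1) one smult)
    fix a b x y
    assume a: "a \<in> carrier ?K" and x: "x \<in> carrier ?V"
    then obtain a' x' where a': "a' \<in> carrier K" "a = \<kappa> a'" and x': "x' \<in> carrier V" "x = \<phi> x'"
      by (auto simp: image_ring_carrier image_module_simps)
    show "a \<odot>\<^bsub>?V\<^esub> x \<in> carrier ?V"
      using a' x' by (simp add: smult) (simp add: image_module_simps)
    show "a \<odot>\<^bsub>?V\<^esub> (x \<oplus>\<^bsub>?V\<^esub> y) = a \<odot>\<^bsub>?V\<^esub> x \<oplus>\<^bsub>?V\<^esub> a \<odot>\<^bsub>?V\<^esub> y" if y: "y \<in> carrier ?V"
    proof -
      obtain y' where "y' \<in> carrier V" "y = \<phi> y'" using y by (auto simp: image_module_simps)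
      then show ?thesis using a' x' by (simp add: vadd smult smult_r_distr)
    qed
    assume "b \<in> carrier ?K"
    then obtain b' where b': "b' \<in> carrier K" "b = \<kappa> b'" by (auto simp: image_ring_carrier)
    show "(a \<oplus>\<^bsub>?K\<^esub> b) \<odot>\<^bsub>?V\<^esub> x = a \<odot>\<^bsub>?V\<^esub> x \<oplus>\<^bsub>?V\<^esub> b \<odot>\<^bsub>?V\<^esub> x"
      using a' b' x' by (simp add: vadd smult add smult_l_distr)
    show "(a \<otimes>\<^bsub>?K\<^esub> b) \<odot>\<^bsub>?V\<^esub> x = a \<odot>\<^bsub>?V\<^esub> (b \<odot>\<^bsub>?V\<^esub> x)"
      using a' b' x' by (simp add: smult mult smult_assoc1)
  qed
  then show "fin_dim_vector_space ?K ?V"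
    by (rule fin_dim_vector_space_if_finite [OF K']) (simp add: image_module_simps V(3))
qed

text \<open>
  An injection into the natural numbers exists for \<open>K\<close> and \<open>V\<close> since they are finite.  It need not
  exist for \<open>H\<close>, but \<open>f\<close> takes its values in the subgroup generated by \<open>f ` X\<close>, which is countable.
\<close>

lemma extension_property_from_nat:
  assumes nat: "extension_property TYPE(nat) TYPE(nat) TYPE(nat) m \<delta> \<epsilon>"
  shows "extension_property TYPE('k) TYPE('v) TYPE('h) m \<delta> \<epsilon>"
  unfolding extension_property_def
proof (intro allI impI)
  fix K :: "'k ring" and V :: "('k, 'v) module" and H :: "'h ring" and X f
  assume K: "finite (carrier K)" "fin_dim_vector_space K V" and H: "abelian_group H"
    and unif: "uniform_subset V \<epsilon> m X" and dens: "\<delta> < density V X"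
    and f: "f \<in> X \<rightarrow> carrier H" "\<forall>c\<in>cubes V m X. cube_sum V H m f c = \<zero>\<^bsub>H\<^esub>"
  interpret V: finite_abelian_group V
    by (rule finite_abelian_group_if_fin_dim [OF K])
  interpret H: abelian_group H by (rule H)
  have X: "X \<subseteq> carrier V" using unif by (simp add: uniform_subset_def)
  obtain \<kappa> :: "'k \<Rightarrow> nat" where \<kappa>: "inj_on \<kappa> (carrier K)"
    using finite_imp_inj_to_nat_seg [OF K(1)] by blast
  obtain \<phi> :: "'v \<Rightarrow> nat" where \<phi>: "inj_on \<phi> (carrier V)"
    using finite_imp_inj_to_nat_seg [OF V.finite_carrier] by blast
  define L where "L = generate (add_monoid H) (f ` X)"
  have fX: "f ` X \<subseteq> carrier (add_monoid H)" using f(1) by auto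
  have "countable L"
    unfolding L_def using finite_subset [OF X V.finite_carrier]
    by (intro countable_generate [OF H.a_group fX] countable_finite finite_imageI)
  then obtain \<chi> :: "'h \<Rightarrow> nat" where \<chi>: "inj_on \<chi> L" by (auto simp: countable_def)
  have sub: "subgroup L (add_monoid H)"
    unfolding L_def by (rule group.generate_is_subgroup [OF H.a_group fX])
  define K' where "K' = image_ring \<kappa> K"
  define V' where "V' = image_module \<kappa> \<phi> K V"
  define H' where "H' = image_ring \<chi> (H\<lparr>carrier := L\<rparr>)"
  let ?\<psi> = "inv_into (carrier V) \<phi>" and ?\<iota> = "inv_into L \<chi>"
  have fieldK: "Ring.field K" and modV: "Module.module K V"
    using K(2) by (simp_all add: fin_dim_vector_space_def)
  note V' = image_module_fin_dim [OF fieldK \<kappa> modV \<phi> V.finite_carrier, folded K'_def V'_def]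
  have H': "additive_hom H' H ?\<iota>"
  proof (rule transported_abelian_group [OF H])
    show "L \<subseteq> carrier H" using subgroup.subset [OF sub] by simp
    show "\<zero>\<^bsub>H\<^esub> \<in> L" using subgroup.one_closed [OF sub] by simp
    show "x \<oplus>\<^bsub>H\<^esub> y \<in> L" if "x \<in> L" "y \<in> L" for x y
      using subgroup.m_closed [OF sub that] by simp
    show "\<ominus>\<^bsub>H\<^esub> x \<in> L" if "x \<in> L" for x
      using subgroup.m_inv_closed [OF sub that] by (simp add: a_inv_def)
    show "inj_on \<chi> L" by (rule \<chi>)
  qed (use \<chi> in \<open>simp_all add: H'_def image_ring_carrier image_ring_zero image_ring_add\<close>)
  have carV': "carrier V' = \<phi> ` carrier V" by (simp add: V'_def image_module_simps)
  have carH': "carrier H' = \<chi> ` L" by (simp add: H'_def image_ring_carrier)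
  have bij: "bij_betw ?\<psi> (carrier V') (carrier V)"
    unfolding carV' using \<phi> by (intro bij_betw_inv_into) (simp add: bij_betw_def)
  have inj: "inj_on ?\<iota> (carrier H')" unfolding carH' by (rule inj_on_inv_into) simp
  have \<psi>: "?\<psi> (\<phi> x) = x" if "x \<in> carrier V" for x using \<phi> that by simp
  define X' where "X' = \<phi> ` X"
  have X': "X' \<subseteq> carrier V'" "?\<psi> ` X' = X"
    using X \<psi> by (auto simp: X'_def carV' image_image subset_iff)
  define f' where "f' y = \<chi> (f (?\<psi> y))" for y
  have fL: "f x \<in> L" if "x \<in> X" for x unfolding L_def using that by (intro generate.incl) simp
  have f': "f' y \<in> carrier H'" "f (?\<psi> y) = ?\<iota> (f' y)" if "y \<in> X'" for y
  proof -
    have "?\<psi> y \<in> X" using that X'(2) by blast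
    then show "f' y \<in> carrier H'" "f (?\<psi> y) = ?\<iota> (f' y)"
      using fL \<chi> by (simp_all add: f'_def carH')
  qed
  interpret H': additive_hom H' H ?\<iota> by (rule H')
  have "\<exists>h\<in>carrier V \<rightarrow> carrier H.
      (\<forall>c\<in>cubes V m (carrier V). cube_sum V H m h c = \<zero>\<^bsub>H\<^esub>) \<and> (\<forall>x\<in>?\<psi> ` X'. h x = f x)"
  proof (rule extension_transfer [where f = f' and f' = f, OF V'(2) bij H' inj X'(1) f'])
    show "\<forall>c\<in>cubes V m (?\<psi> ` X'). cube_sum V H m f c = \<zero>\<^bsub>H\<^esub>" using f(2) by (simp add: X'(2))
    assume zero: "\<forall>c\<in>cubes V' m X'. cube_sum V' H' m f' c = \<zero>\<^bsub>H'\<^esub>"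
    have finK': "finite (carrier K')" using K(1) by (simp add: K'_def image_ring_carrier)
    have unif': "uniform_subset V' \<epsilon> m X'"
      using unif uniform_subset_iso(2) [OF V'(2) bij X'(1)] by (simp add: X'(2))
    have dens': "\<delta> < density V' X'"
      using dens uniform_subset_iso(1) [OF V'(2) bij X'(1)] by (simp add: X'(2))
    have "f' \<in> X' \<rightarrow> carrier H'" using f'(1) by blast
    then show "\<exists>h\<in>carrier V' \<rightarrow> carrier H'.
        (\<forall>c\<in>cubes V' m (carrier V'). cube_sum V' H' m h c = \<zero>\<^bsub>H'\<^esub>) \<and> (\<forall>x\<in>X'. h x = f' x)"
      by (rule nat [unfolded extension_property_def, rule_format, OF finK' V'(1)
          H'.G.abelian_group_axioms unif' dens']) (rule bspec [OF zero])
  qed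
  then show "\<exists>h\<in>carrier V \<rightarrow> carrier H.
      (\<forall>c\<in>cubes V m (carrier V). cube_sum V H m h c = \<zero>\<^bsub>H\<^esub>) \<and> (\<forall>x\<in>X. h x = f x)"
    by (simp only: X'(2))
qed

section \<open>Extension from uniform subsets\<close>

theorem theorem1p6:
  fixes m :: nat
  assumes "m \<ge> 1"
  shows "(\<exists>C::nat. \<forall>\<delta>>0. \<exists>\<epsilon>>0. \<epsilon> = \<delta> ^ C \<and>
            extension_property TYPE(nat) TYPE(nat) TYPE(nat) m \<delta> \<epsilon>) \<and>
         (\<forall>\<delta>>0. \<forall>\<epsilon>>0. extension_property TYPE(nat) TYPE(nat) TYPE(nat) m \<delta> \<epsilon> \<longrightarrow>
            extension_property TYPE('k) TYPE('v) TYPE('h) m \<delta> \<epsilon>)"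
proof
  let ?N = "card (configuration_index m)"
  obtain C where C: "\<And>\<delta>::real. 0 < \<delta> \<Longrightarrow> \<delta> \<le> 1 - 1 / real ?N \<longrightarrow> real ?N * \<delta> ^ C \<le> \<delta> ^ ?N"
    using polynomial_smallness_exists [of ?N] by blast
  have "extension_property TYPE(nat) TYPE(nat) TYPE(nat) m \<delta> (\<delta> ^ C)" if "0 < \<delta>" for \<delta>
    by (rule extension_property_power [OF assms C [OF that] that])
  then show "\<exists>C::nat. \<forall>\<delta>>0. \<exists>\<epsilon>>0. \<epsilon> = \<delta> ^ C \<and>
      extension_property TYPE(nat) TYPE(nat) TYPE(nat) m \<delta> \<epsilon>"
    by (intro exI [of _ C]) simp
  show "\<forall>\<delta>>0. \<forall>\<epsilon>>0. extension_property TYPE(nat) TYPE(nat) TYPE(nat) m \<delta> \<epsilon> \<longrightarrow>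
      extension_property TYPE('k) TYPE('v) TYPE('h) m \<delta> \<epsilon>"
    using extension_property_from_nat by blast
qed

end
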